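(* Let $p$ be a prime, let $\mathbb{Z}/p\mathbb{Z}$ be equipped with a metric group structure, and let $E\colon\mathbb{Z}/p\mathbb{Z}\to\mathbb{C}$ be a finite quantum dilogarithm. Then $E(u)\in\overline{\mathbb{Q}}$ for all $u\in\mathbb{Z}/p\mathbb{Z}$.
   Context: A metric group is a finite abelian group $G$ together with a function $\langle\cdot\rangle\colon G\to\mathbb{C}^\times$ such that $\langle x\rangle=\langle -x\rangle$ for all $x$ and $\langle x;y\rangle:=\dfrac{\langle x+y\rangle}{\langle x\rangle\langle y\rangle}$ is a non-degenerate bicharacter on $G$. Let $N=|G|$. A finite quantum dilogarithm for a metric group $G$ is a function $E\colon G\to\mathbb{C}$ such that for some non-zero constant $C\in\mathbb{C}^\times$ and all $x,y\in G$, $$\langle x;y\rangle E(x)E(y)=C+\frac1{\sqrt N}\sum_{z\in G}E(y-z)E(z)\langle z\rangle E(x-z),$$ and which, when $|G|\le4$, is in addition required to satisfy $E(0)^2=\sqrt{N}\,E(0)+1$. *)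

theory Defs
  imports
    Complex_Main
    "HOL-Algebra.Elementary_Groups"
    "HOL-Computational_Algebra.Primes"
    "HOL-Computational_Algebra.Polynomial"
begin

text \<open>
  Groups are multiplicative: \<open>x \<otimes> y\<close>, \<open>inv x\<close>, \<open>\<one>\<close> stand for \<open>x + y\<close>, \<open>-x\<close>, \<open>0\<close> in additive
  notation. Functions on a group are constrained on its carrier only. The function \<open>q\<close> is
  \<open>x \<mapsto> \<langle>x\<rangle>\<close>, and \<open>pairing G q x y\<close> is \<open>\<langle>x;y\<rangle>\<close>.
\<close>

definition bicharacter :: "('a, 'b) monoid_scheme \<Rightarrow> ('a \<Rightarrow> 'a \<Rightarrow> complex) \<Rightarrow> bool" where
  "bicharacter G b \<longleftrightarrow>
     (\<forall>x\<in>carrier G. \<forall>y\<in>carrier G. b x y \<noteq> 0) \<and>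
     (\<forall>x\<in>carrier G. \<forall>x'\<in>carrier G. \<forall>y\<in>carrier G. b (x \<otimes>\<^bsub>G\<^esub> x') y = b x y * b x' y) \<and>
     (\<forall>x\<in>carrier G. \<forall>y\<in>carrier G. \<forall>y'\<in>carrier G. b x (y \<otimes>\<^bsub>G\<^esub> y') = b x y * b x y')"

definition nondegenerate :: "('a, 'b) monoid_scheme \<Rightarrow> ('a \<Rightarrow> 'a \<Rightarrow> complex) \<Rightarrow> bool" where
  "nondegenerate G b \<longleftrightarrow>
     (\<forall>x\<in>carrier G. (\<forall>y\<in>carrier G. b x y = 1) \<longrightarrow> x = \<one>\<^bsub>G\<^esub>) \<and>
     (\<forall>y\<in>carrier G. (\<forall>x\<in>carrier G. b x y = 1) \<longrightarrow> y = \<one>\<^bsub>G\<^esub>)"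

definition pairing :: "('a, 'b) monoid_scheme \<Rightarrow> ('a \<Rightarrow> complex) \<Rightarrow> 'a \<Rightarrow> 'a \<Rightarrow> complex" where
  "pairing G q x y = q (x \<otimes>\<^bsub>G\<^esub> y) / (q x * q y)"

locale metric_group = comm_group G for G (structure) +
  fixes q :: "'a \<Rightarrow> complex"
  assumes finite_carrier: "finite (carrier G)"
    and q_nonzero: "x \<in> carrier G \<Longrightarrow> q x \<noteq> 0"
    and q_even: "x \<in> carrier G \<Longrightarrow> q x = q (inv x)"
    and bicharacter_pairing: "bicharacter G (pairing G q)"
    and nondegenerate_pairing: "nondegenerate G (pairing G q)"

definition finite_quantum_dilogarithm ::
  "('a, 'b) monoid_scheme \<Rightarrow> ('a \<Rightarrow> complex) \<Rightarrow> ('a \<Rightarrow> complex) \<Rightarrow> bool" where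
  "finite_quantum_dilogarithm G q E \<longleftrightarrow>
     (\<exists>C. C \<noteq> 0 \<and>
       (\<forall>x\<in>carrier G. \<forall>y\<in>carrier G.
          pairing G q x y * E x * E y =
            C + 1 / complex_of_real (sqrt (real (Coset.order G))) *
              (\<Sum>z\<in>carrier G.
                 E (y \<otimes>\<^bsub>G\<^esub> inv\<^bsub>G\<^esub> z) * E z * q z * E (x \<otimes>\<^bsub>G\<^esub> inv\<^bsub>G\<^esub> z)))) \<and>
     (Coset.order G \<le> 4 \<longrightarrow>
       (E \<one>\<^bsub>G\<^esub>)\<^sup>2 = complex_of_real (sqrt (real (Coset.order G))) * E \<one>\<^bsub>G\<^esub> + 1)"

end

theory Submission
  imports Defs
begin

text \<open>
  A complex number lying in every valuation ring \<open>V \<supseteq> \<rat>\<close> of \<open>\<complex>\<close> is algebraic. The pentagon equation,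
  Fourier transformed in one variable, forces \<open>E(0)\<^sup>2 = \<surd>N E(0) + 1\<close>, \<open>\<langle>x\<rangle> E(x) E(-x) = 1\<close> for
  \<open>x \<noteq> 0\<close>, and proportionality of the Fourier transform of \<open>E\<close> at \<open>-x\<close> to \<open>\<langle>x\<rangle> E(x)\<close>, apart from a
  degenerate case which is settled directly. If some value of \<open>E\<close> were outside \<open>V\<close>, divide \<open>E\<close> by one
  of its values, dominant with respect to \<open>V\<close>, to get \<open>f\<close>. Modulo the maximal ideal, \<open>f(0) = 0\<close> and \<open>f(x) f(-x) = 0\<close>, so
  \<open>f\<close> and its Fourier transform have supports \<open>A\<close> and \<open>-A\<close> with \<open>A\<close>, \<open>-A\<close>, \<open>{0}\<close> disjoint. As
  \<open>2 |A| < p\<close>, this contradicts Chebotarev's theorem that all minors of the Fourier matrix of prime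
  order are nonzero, equivalently the uncertainty principle \<open>|supp f| + |supp f^| > p\<close>.
\<close>

section \<open>Valuation rings\<close>

text \<open>Ring and maximal ideal are carried as a pair. Since an element outside \<open>V\<close>
  has its inverse in \<open>I\<close>, and \<open>1 \<notin> I\<close>, the ideal consists of
  exactly the non-units of \<open>V\<close>, and working modulo \<open>I\<close> means working in
  the residue field.\<close>

locale valuation_ring =
  fixes V I :: "'a::field set"
  assumes one_closed: "1 \<in> V"
    and diff_closed: "x \<in> V \<Longrightarrow> y \<in> V \<Longrightarrow> x - y \<in> V"
    and mult_closed: "x \<in> V \<Longrightarrow> y \<in> V \<Longrightarrow> x * y \<in> V"
    and ideal_subset: "I \<subseteq> V"
    and ideal_zero: "0 \<in> I"
    and ideal_add: "x \<in> I \<Longrightarrow> y \<in> I \<Longrightarrow> x + y \<in> I"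
    and ideal_mult: "x \<in> V \<Longrightarrow> y \<in> I \<Longrightarrow> x * y \<in> I"
    and one_notin_ideal: "1 \<notin> I"
    and inverse_in_ideal: "x \<notin> V \<Longrightarrow> inverse x \<in> I"
begin

lemma in_V: "x \<in> I \<Longrightarrow> x \<in> V"
  using ideal_subset by blast

lemma zero_closed: "0 \<in> V"
  using in_V ideal_zero by blast

lemma uminus_closed: "x \<in> V \<Longrightarrow> - x \<in> V"
  using diff_closed[OF zero_closed] by simp

lemma add_closed: "x \<in> V \<Longrightarrow> y \<in> V \<Longrightarrow> x + y \<in> V"
  using diff_closed[of x "- y"] uminus_closed[of y] by simp

lemma ideal_mult_right: "x \<in> I \<Longrightarrow> y \<in> V \<Longrightarrow> x * y \<in> I"
  using ideal_mult[of y x] by (simp add: mult.commute)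

lemma ideal_uminus: "x \<in> I \<Longrightarrow> - x \<in> I"
  using ideal_mult[OF uminus_closed[OF one_closed]] by simp

lemma ideal_diff: "x \<in> I \<Longrightarrow> y \<in> I \<Longrightarrow> x - y \<in> I"
  using ideal_add[of x "- y"] ideal_uminus[of y] by simp

lemma sum_closed: "(\<And>i. i \<in> A \<Longrightarrow> f i \<in> V) \<Longrightarrow> sum f A \<in> V"
  by (induction A rule: infinite_finite_induct) (auto intro: zero_closed add_closed)

lemma ideal_sum: "(\<And>i. i \<in> A \<Longrightarrow> f i \<in> I) \<Longrightarrow> sum f A \<in> I"
  by (induction A rule: infinite_finite_induct) (auto intro: ideal_zero ideal_add)

lemma power_closed: "x \<in> V \<Longrightarrow> x ^ n \<in> V"
  by (induction n) (auto intro: one_closed mult_closed)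

lemma ideal_power: "x \<in> I \<Longrightarrow> 0 < n \<Longrightarrow> x ^ n \<in> I"
  by (cases n) (auto intro: ideal_mult_right power_closed in_V)

lemma of_nat_closed: "of_nat n \<in> V"
  by (induction n) (auto intro: zero_closed one_closed add_closed)

lemma of_int_closed: "of_int k \<in> V"
  by (cases k) (auto intro: of_nat_closed uminus_closed simp del: of_nat_Suc)

lemma inverse_closed: "x \<notin> I \<Longrightarrow> inverse x \<in> V"
  using inverse_in_ideal[of "inverse x"] in_V inverse_in_ideal[of x] by auto

lemma ideal_prime: "x * y \<in> I \<Longrightarrow> x \<in> I \<or> y \<in> I"
proof (rule ccontr)
  assume *: "x * y \<in> I" "\<not> (x \<in> I \<or> y \<in> I)"
  then have nz: "x \<noteq> 0" "y \<noteq> 0"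
    using ideal_zero by auto
  have "inverse x * inverse y * (x * y) \<in> I"
    using * by (intro ideal_mult[OF mult_closed[OF inverse_closed inverse_closed]]) auto
  with nz one_notin_ideal show False
    by (simp add: field_simps)
qed

lemma ideal_prime_prod:
  "finite A \<Longrightarrow> prod f A \<in> I \<Longrightarrow> \<exists>i\<in>A. f i \<in> I"
  by (induction A rule: finite_induct) (use one_notin_ideal ideal_prime in auto)

lemma ideal_prime_power: "x ^ n \<in> I \<Longrightarrow> x \<in> I"
  by (induction n) (use one_notin_ideal ideal_prime in auto)

text \<open>Valuation rings are integrally closed; this instance places roots of unity and square
  roots of integers in \<open>V\<close>.\<close>

lemma power_closed_iff:
  assumes "0 < n" "x ^ n \<in> V" shows "x \<in> V"
proof (rule ccontr)
  assume "x \<notin> V"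
  then have "inverse x ^ n \<in> I" and "x \<noteq> 0"
    using inverse_in_ideal ideal_power assms(1) zero_closed by auto
  then have "x ^ n * inverse x ^ n \<in> I"
    using ideal_mult assms(2) by blast
  with \<open>x \<noteq> 0\<close> one_notin_ideal show False
    by (simp flip: power_mult_distrib)
qed

text \<open>If \<open>e\<close> were outside \<open>V\<close>, dividing the equation by
  \<open>e ^ 2\<close> would write 1 as a sum of elements of \<open>I\<close>.\<close>

lemma quadratic_root_closed:
  assumes "s \<in> V" "e ^ 2 = s * e + 1"
  shows "e \<in> V"
proof (rule ccontr)
  assume "e \<notin> V"
  then have inv: "inverse e \<in> I" and "e \<noteq> 0"
    using inverse_in_ideal zero_closed by auto
  have "s * inverse e + inverse e ^ 2 = inverse e ^ 2 * (s * e + 1)"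
    using \<open>e \<noteq> 0\<close> by (simp add: field_simps power2_eq_square)
  also have "\<dots> = 1"
    using \<open>e \<noteq> 0\<close> by (simp flip: assms(2) power_mult_distrib)
  finally have "1 = s * inverse e + inverse e ^ 2" ..
  also have "\<dots> \<in> I"
    using assms(1) inv by (intro ideal_add ideal_mult ideal_power) auto
  finally show False
    using one_notin_ideal by contradiction
qed

text \<open>Of two nonzero elements, one divides the other in \<open>V\<close>. The induction
  therefore keeps whichever of the new value and the former maximum is larger.\<close>

lemma exists_dominant:
  assumes "finite A" "a \<in> A" "f a \<noteq> 0"
  shows "\<exists>m\<in>A. f m \<noteq> 0 \<and> (\<forall>x\<in>A. f x / f m \<in> V)"
  using assms
proof (induction A arbitrary: a rule: finite_induct)
  case (insert b A)
  show ?case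
  proof (cases "\<exists>a\<in>A. f a \<noteq> 0")
    case False
    then have "f b \<noteq> 0"
      using insert.prems by auto
    with False show ?thesis
      by (auto intro: one_closed zero_closed)
  next
    case True
    then obtain m where m: "m \<in> A" "f m \<noteq> 0" "\<forall>x\<in>A. f x / f m \<in> V"
      using insert.IH by blast
    show ?thesis
    proof (cases "f b / f m \<in> V")
      case False
      then have *: "f m / f b \<in> V" "f b \<noteq> 0"
        using inverse_in_ideal[OF False] in_V zero_closed by (auto simp: field_simps)
      have "f x / f b \<in> V" if "x \<in> A" for x
        using mult_closed[of "f x / f m" "f m / f b"] m * that by simp
      with * show ?thesis
        by (auto intro!: bexI[of _ b] intro: one_closed)
    qed (use m in auto)
  qed
qed simp

end

text \<open>
  The maximal ones turn out to be the maximal ideals of valuation rings, whose ring is recovered as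
  the multiplier ring \<open>{x. x J \<subseteq> J}\<close>. Working with one set instead of the pair (ring, ideal) makes
  Zorn's lemma for set inclusion applicable.
\<close>

definition proper_rng :: "'a::field set \<Rightarrow> 'a set \<Rightarrow> bool" where
  "proper_rng R J \<longleftrightarrow> 0 \<in> J \<and> 1 \<notin> J \<and> (\<forall>x\<in>J. \<forall>y\<in>J. x - y \<in> J) \<and>
     (\<forall>x\<in>J. \<forall>y\<in>J. x * y \<in> J) \<and> (\<forall>r\<in>R. \<forall>x\<in>J. r * x \<in> J)"

lemma exists_maximal_proper_rng:
  assumes "proper_rng R J0"
  obtains J where "proper_rng R J" "J0 \<subseteq> J" "\<And>K. proper_rng R K \<Longrightarrow> J \<subseteq> K \<Longrightarrow> K = J"
proof -
  let ?A = "{J. proper_rng R J \<and> J0 \<subseteq> J}"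
  have "\<exists>M\<in>?A. \<forall>X\<in>?A. M \<subseteq> X \<longrightarrow> X = M"
  proof (rule subset_Zorn_nonempty)
    fix C assume C: "C \<noteq> {}" "subset.chain ?A C"
    then have mem: "\<And>J. J \<in> C \<Longrightarrow> proper_rng R J \<and> J0 \<subseteq> J"
      and lin: "\<And>J K. J \<in> C \<Longrightarrow> K \<in> C \<Longrightarrow> J \<subseteq> K \<or> K \<subseteq> J"
      unfolding subset.chain_def by blast+
    have common: "\<exists>L\<in>C. x \<in> L \<and> y \<in> L" if "x \<in> \<Union>C" "y \<in> \<Union>C" for x y
      using that lin by blast
    have "proper_rng R (\<Union>C)"
      unfolding proper_rng_def
    proof (intro conjI ballI)
      show "0 \<in> \<Union>C" "1 \<notin> \<Union>C"
        using C(1) mem unfolding proper_rng_def by blast+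
      fix x y assume "x \<in> \<Union>C" "y \<in> \<Union>C"
      then show "x - y \<in> \<Union>C" "x * y \<in> \<Union>C"
        using common[of x y] mem unfolding proper_rng_def by blast+
    next
      fix r x assume "r \<in> R" "x \<in> \<Union>C"
      then show "r * x \<in> \<Union>C"
        using mem unfolding proper_rng_def by blast
    qed
    with C(1) mem show "\<Union>C \<in> ?A"
      by blast
  qed (use assms in auto)
  then obtain M where M: "M \<in> ?A" "\<forall>X\<in>?A. M \<subseteq> X \<longrightarrow> X = M" ..
  show thesis
  proof (rule that)
    show "K = M" if "proper_rng R K" "M \<subseteq> K" for K
      using M(1) that by (intro M(2)[rule_format]) auto
  qed (use M(1) in auto)
qed

section \<open>From a maximal proper subring without unit to a valuation ring\<close>

context
  fixes R J :: "'a::field set"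
  assumes J: "proper_rng R J"
    and maximal: "\<And>K. proper_rng R K \<Longrightarrow> J \<subseteq> K \<Longrightarrow> K = J"
begin

lemma J_closed:
  "0 \<in> J" "1 \<notin> J" "x \<in> J \<Longrightarrow> y \<in> J \<Longrightarrow> x - y \<in> J" "x \<in> J \<Longrightarrow> y \<in> J \<Longrightarrow> x * y \<in> J"
  "r \<in> R \<Longrightarrow> x \<in> J \<Longrightarrow> r * x \<in> J"
  using J unfolding proper_rng_def by auto

lemma J_add: "x \<in> J \<Longrightarrow> y \<in> J \<Longrightarrow> x + y \<in> J"
  using J_closed(3)[of x "0 - y"] J_closed(3)[of 0 y] J_closed(1) by simp

lemma J_sum: "(\<And>i. i \<in> A \<Longrightarrow> f i \<in> J) \<Longrightarrow> sum f A \<in> J"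
  by (induction A rule: infinite_finite_induct) (auto intro: J_closed J_add)

text \<open>A member with \<open>poly P x = 1\<close> witnesses that adjoining \<open>x\<close> to
  \<open>J\<close> would produce 1. The degree is only bounded, so that the bound can be the measure
  of a descent.\<close>

definition J_poly :: "nat \<Rightarrow> 'a poly set" where
  "J_poly n = {P. (\<forall>i. coeff P i \<in> J) \<and> degree P \<le> n}"

text \<open>Localization at the elements \<open>1 - y\<close> with \<open>y \<in> J\<close> does not
  produce 1, as \<open>x / (1 - y) = 1\<close> would give \<open>x + y = 1\<close>. By maximality
  the localization is \<open>J\<close> itself.\<close>

lemma J_divide_one_minus:
  assumes a: "a \<in> J" and b: "b \<in> J"
  shows "a / (1 - b) \<in> J"
proof -
  let ?K = "{x / (1 - y) |x y. x \<in> J \<and> y \<in> J}"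
  have ne: "1 - y \<noteq> 0" if "y \<in> J" for y
    using that J_closed(2) by auto
  have mult: "x * (1 - y) \<in> J" if "x \<in> J" "y \<in> J" for x y
    using J_closed that by (simp add: right_diff_distrib)
  have den: "(1 - y) * (1 - y') = 1 - (y + y' - y * y')" for y y' :: 'a
    by (simp add: algebra_simps)
  have den_in: "y + y' - y * y' \<in> J" if "y \<in> J" "y' \<in> J" for y y'
    using that by (intro J_closed J_add)
  have KI: "u \<in> ?K" if "u = x / (1 - y)" "x \<in> J" "y \<in> J" for u x y
    using that by blast
  have "proper_rng R ?K"
    unfolding proper_rng_def
  proof (intro conjI ballI)
    show "0 \<in> ?K"
      by (rule KI[of _ 0 0]) (auto intro: J_closed)
    show "1 \<notin> ?K"
    proof
      assume "1 \<in> ?K"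
      then obtain x y where "1 = x / (1 - y)" "x \<in> J" "y \<in> J" by blast
      then have "x + y = 1" "x + y \<in> J"
        using ne[of y] J_add[of x y] by (auto simp: field_simps)
      with J_closed(2) show False by metis
    qed
  next
    fix u v assume "u \<in> ?K" "v \<in> ?K"
    then obtain x y x' y' where *: "u = x / (1 - y)" "v = x' / (1 - y')"
      "x \<in> J" "y \<in> J" "x' \<in> J" "y' \<in> J" by blast
    have "u - v = (x * (1 - y') - x' * (1 - y)) / (1 - (y + y' - y * y'))"
      using * ne[of y] ne[of y'] unfolding den[symmetric] by (simp add: diff_frac_eq)
    then show "u - v \<in> ?K"
      by (rule KI) (use * in \<open>auto intro: J_closed(3) mult den_in\<close>)
    have "u * v = (x * x') / (1 - (y + y' - y * y'))"
      using * unfolding den[symmetric] by simp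
    then show "u * v \<in> ?K"
      by (rule KI) (use * in \<open>auto intro: J_closed(4) den_in\<close>)
  next
    fix r u assume "r \<in> R" "u \<in> ?K"
    then obtain x y where *: "u = x / (1 - y)" "x \<in> J" "y \<in> J" by blast
    show "r * u \<in> ?K"
      by (rule KI[of _ "r * x" y]) (use * \<open>r \<in> R\<close> in \<open>auto intro: J_closed(5)\<close>)
  qed
  moreover have "J \<subseteq> ?K"
    by (intro subsetI KI[of _ _ 0]) (auto intro: J_closed)
  ultimately have "?K = J"
    by (rule maximal)
  with a b show ?thesis by blast
qed

text \<open>The relation for \<open>inverse x\<close> expresses 1 by strictly negative powers of
  \<open>x\<close>, after division by \<open>1 - b\<close>. Substituting this into the top term of
  \<open>P\<close> lowers the degree, and \<open>m \<le> n\<close> keeps all exponents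
  nonnegative.\<close>

lemma J_poly_reduce:
  assumes P: "P \<in> J_poly n" "poly P x = 1" and Q: "Q \<in> J_poly m" "poly Q (inverse x) = 1"
    and "x \<noteq> 0" "m \<le> n"
  shows "\<exists>P'\<in>J_poly (n - 1). poly P' x = 1"
proof -
  have Pj: "coeff P i \<in> J" and Qj: "coeff Q i \<in> J" for i
    using P Q by (auto simp: J_poly_def)
  have n: "n > 0"
  proof (rule ccontr)
    assume "\<not> n > 0"
    then have "coeff P 0 = 1"
      using P by (auto simp: J_poly_def poly_altdef)
    with Pj[of 0] J_closed show False by simp
  qed
  define b where "b = coeff Q 0"
  have b: "1 - b \<noteq> 0" "b \<in> J"
    using Qj[of 0] J_closed by (auto simp: b_def)
  define c where "c = coeff P n / (1 - b)"
  have c: "c \<in> J"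
    unfolding c_def by (rule J_divide_one_minus[OF Pj b(2)])
  \<comment> \<open>\<open>P1\<close> is \<open>P\<close> without its top term; \<open>P2\<close> is
    that term rewritten in lower powers, with the division by \<open>1 - b\<close> absorbed into
    \<open>c\<close>.\<close>
  define P1 where "P1 = P - monom (coeff P n) n"
  define P2 where "P2 = (\<Sum>j=1..m. monom (c * coeff Q j) (n - j))"
  have one: "(\<Sum>i\<le>m. coeff Q i * inverse x ^ i) = 1"
    using Q by (subst (asm) poly_as_sum_of_monoms'[of Q m, symmetric]) (auto simp: J_poly_def poly_sum poly_monom)
  have "1 - b = (\<Sum>j=1..m. coeff Q j * inverse x ^ j)"
    unfolding one[symmetric] atMost_atLeast0 b_def by (simp add: sum.atLeast_Suc_atMost)
  then have "coeff P n * x ^ n = c * x ^ n * (\<Sum>j=1..m. coeff Q j * inverse x ^ j)"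
    using b(1) by (simp add: c_def)
  also have "\<dots> = poly P2 x"
    unfolding P2_def poly_sum poly_monom sum_distrib_left
    using \<open>m \<le> n\<close> \<open>x \<noteq> 0\<close>
    by (intro sum.cong) (auto simp: power_diff power_inverse field_simps)
  finally have "poly (P1 + P2) x = 1"
    using P(2) by (simp add: P1_def poly_monom)
  moreover have "P1 + P2 \<in> J_poly (n - 1)"
    unfolding J_poly_def mem_Collect_eq
  proof (intro conjI allI)
    fix i
    show "coeff (P1 + P2) i \<in> J"
      unfolding P1_def P2_def coeff_add coeff_diff coeff_sum coeff_monom
      using Pj Qj c J_closed(1,3,4) by (auto intro!: J_add J_sum)
  next
    show "degree (P1 + P2) \<le> n - 1"
    proof (rule degree_le, intro allI impI)
      fix i assume i: "n - 1 < i"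
      have "coeff P i = 0" if "i \<noteq> n"
        using P(1) i that by (intro coeff_eq_0) (auto simp: J_poly_def)
      then have "coeff P1 i = 0"
        by (auto simp: P1_def)
      moreover have "coeff P2 i = 0"
        unfolding P2_def coeff_sum coeff_monom using i \<open>m \<le> n\<close>
        by (intro sum.neutral) auto
      ultimately show "coeff (P1 + P2) i = 0" by simp
    qed
  qed
  ultimately show ?thesis by blast
qed

text \<open>Descent on the sum of the two degree bounds: the larger one is always reducible, with
  \<open>x\<close> and \<open>inverse x\<close> exchanged if necessary, and bound 0 would put 1 into
  \<open>J\<close>.\<close>

lemma J_poly_not_both:
  assumes "P \<in> J_poly n" "poly P x = 1" "Q \<in> J_poly m" "poly Q (inverse x) = 1" "x \<noteq> 0"
  shows False
  using assms
proof (induction "n + m" arbitrary: n m P Q x rule: less_induct)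
  case less
  have pos: "n > 0" if "P \<in> J_poly n" "poly P x = 1" for P n x
  proof (rule ccontr)
    assume "\<not> n > 0"
    then have "coeff P 0 = 1"
      using that by (auto simp: J_poly_def poly_altdef)
    with that J_closed show False by (metis (mono_tags, lifting) J_poly_def mem_Collect_eq)
  qed
  have n: "n > 0" and m: "m > 0"
    using pos less.prems by blast+
  show False
  proof (cases "m \<le> n")
    case True
    then obtain P' where "P' \<in> J_poly (n - 1)" "poly P' x = 1"
      using J_poly_reduce less.prems by blast
    then show False
      using less.hyps[of "n - 1" m P' x Q] less.prems n by simp
  next
    case False
    then obtain Q' where "Q' \<in> J_poly (m - 1)" "poly Q' (inverse x) = 1"
      using J_poly_reduce[of Q m "inverse x" P n] less.prems by auto
    then show False
      using less.hyps[of n "m - 1" P x Q'] less.prems m by simp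
  qed
qed

text \<open>The hypothesis says that the polynomials in \<open>x\<close> with coefficients in
  \<open>J\<close> do not produce 1. Their values form a proper extension candidate of
  \<open>J\<close>, so by maximality they add nothing, and \<open>x * j\<close> is one of
  them.\<close>

lemma multiplier_if_poly_ne_1:
  assumes ne: "\<And>P n. P \<in> J_poly n \<Longrightarrow> poly P x \<noteq> 1" and "j \<in> J"
  shows "x * j \<in> J"
proof -
  let ?K = "{poly P x |P. \<forall>i. coeff P i \<in> J}"
  have KI: "u \<in> ?K" if "u = poly P x" "\<And>i. coeff P i \<in> J" for u P
    using that by blast
  have "proper_rng R ?K"
    unfolding proper_rng_def
  proof (intro conjI ballI)
    show "0 \<in> ?K"
      by (rule KI[of _ 0]) (auto intro: J_closed)
    show "1 \<notin> ?K"
    proof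
      assume "1 \<in> ?K"
      then obtain P where "poly P x = 1" "\<forall>i. coeff P i \<in> J" by auto
      with ne[of P "degree P"] show False
        by (simp add: J_poly_def)
    qed
  next
    fix u v assume "u \<in> ?K" "v \<in> ?K"
    then obtain P Q where *: "u = poly P x" "v = poly Q x"
      "\<And>i. coeff P i \<in> J" "\<And>i. coeff Q i \<in> J" by blast
    show "u - v \<in> ?K"
      by (rule KI[of _ "P - Q"]) (use * in \<open>auto intro: J_closed\<close>)
    show "u * v \<in> ?K"
      by (rule KI[of _ "P * Q"]) (use * in \<open>auto simp: coeff_mult intro!: J_closed(4) J_sum\<close>)
  next
    fix r u assume "r \<in> R" "u \<in> ?K"
    then obtain P where "u = poly P x" "\<And>i. coeff P i \<in> J" by blast
    then show "r * u \<in> ?K"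
      using \<open>r \<in> R\<close> by (intro KI[of _ "smult r P"]) (auto intro: J_closed)
  qed
  moreover have "J \<subseteq> ?K"
  proof
    fix j assume "j \<in> J" then show "j \<in> ?K"
      by (intro KI[of _ "[:j:]"]) (auto simp: coeff_pCons J_closed split: nat.splits)
  qed
  ultimately have "?K = J"
    by (rule maximal)
  moreover have "x * j \<in> ?K"
    using \<open>j \<in> J\<close> by (intro KI[of _ "[:0, j:]"]) (auto simp: coeff_pCons J_closed split: nat.splits)
  ultimately show ?thesis by simp
qed

text \<open>If \<open>x\<close> is not a multiplier, adjoining it to \<open>J\<close> yields 1.
  Adjoining \<open>inverse x\<close> then does not, so \<open>inverse x\<close> is a multiplier; a
  second use of maximality puts it into \<open>J\<close>.\<close>

lemma multiplier_valuation_ring: "valuation_ring {x. \<forall>j\<in>J. x * j \<in> J} J"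
proof
  let ?V = "{x. \<forall>j\<in>J. x * j \<in> J}"
  show "1 \<in> ?V" "0 \<in> J" "1 \<notin> J" "J \<subseteq> ?V"
    using J_closed by auto
  show "x - y \<in> ?V" if "x \<in> ?V" "y \<in> ?V" for x y
    using that J_closed by (auto simp: left_diff_distrib)
  show "x * y \<in> ?V" if "x \<in> ?V" "y \<in> ?V" for x y
    using that J_closed by (auto simp: mult.assoc)
  show "x + y \<in> J" if "x \<in> J" "y \<in> J" for x y
    using that by (rule J_add)
  show "x * y \<in> J" if "x \<in> ?V" "y \<in> J" for x y
    using that by blast
  fix x assume x: "x \<notin> ?V"
  then have "x \<noteq> 0"
    using J_closed(1) by auto
  obtain P n where "P \<in> J_poly n" "poly P x = 1"
    using x multiplier_if_poly_ne_1[of x] by blast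
  then have inv: "inverse x * j \<in> J" if "j \<in> J" for j
    using multiplier_if_poly_ne_1[of "inverse x" j] J_poly_not_both[of P n x] \<open>x \<noteq> 0\<close> that by blast
  \<comment> \<open>This is \<open>J\<close> enlarged by the \<open>?V\<close>-multiples of
    \<open>inverse x\<close>. It is closed under products because \<open>inverse x\<close> is a
    multiplier, and it misses 1 because \<open>1 = j + r * inverse x\<close> would make
    \<open>x = r / (1 - j)\<close> a multiplier.\<close>
  let ?K = "{j + r * inverse x |j r. j \<in> J \<and> r \<in> ?V}"
  have KI: "u \<in> ?K" if "u = j + r * inverse x" "j \<in> J" "r \<in> ?V" for u j r
    using that by blast
  have V_add: "u + v \<in> ?V" if "u \<in> ?V" "v \<in> ?V" for u v
    using that by (auto simp: distrib_right intro: J_add)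
  have "proper_rng R ?K"
    unfolding proper_rng_def
  proof (intro conjI ballI)
    show "0 \<in> ?K"
      by (rule KI[of _ 0 0]) (auto intro: J_closed)
    show "1 \<notin> ?K"
    proof
      assume "1 \<in> ?K"
      then obtain j r where jr: "1 = j + r * inverse x" "j \<in> J" "r \<in> ?V" by blast
      then have "1 - j \<noteq> 0"
        using J_closed(2) by auto
      with jr(1) \<open>x \<noteq> 0\<close> have "x = r / (1 - j)"
        by (simp add: field_simps)
      then have "x * k = r * (k / (1 - j))" for k
        by simp
      then have "x \<in> ?V"
        using jr J_divide_one_minus by auto
      with x show False by contradiction
    qed
  next
    fix u v assume "u \<in> ?K" "v \<in> ?K"
    then obtain j r j' r' where *: "u = j + r * inverse x" "v = j' + r' * inverse x"
      "j \<in> J" "r \<in> ?V" "j' \<in> J" "r' \<in> ?V" by blast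
    show "u - v \<in> ?K"
      by (rule KI[of _ "j - j'" "r - r'"])
        (use * in \<open>auto simp: left_diff_distrib intro: J_closed\<close>)
    have "r * j' + r' * j \<in> ?V"
      using * J_closed(4) by (auto simp: distrib_right mult.assoc intro!: J_add)
    moreover have "r * r' * inverse x \<in> ?V"
      using * inv by (simp add: mult.assoc)
    ultimately have "r * j' + r' * j + r * r' * inverse x \<in> ?V"
      by (rule V_add)
    then show "u * v \<in> ?K"
      by (rule KI[of _ "j * j'", rotated 2])
        (use * in \<open>auto simp: algebra_simps intro: J_closed\<close>)
  next
    fix s u assume "s \<in> R" "u \<in> ?K"
    then obtain j r where "u = j + r * inverse x" "j \<in> J" "r \<in> ?V" by blast
    with \<open>s \<in> R\<close> show "s * u \<in> ?K"
      by (intro KI[of _ "s * j" "s * r"]) (auto simp: distrib_left mult.assoc intro: J_closed)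
  qed
  moreover have "J \<subseteq> ?K"
    by (intro subsetI KI[of _ _ 0]) (auto intro: J_closed)
  ultimately have "?K = J"
    by (rule maximal)
  moreover have "inverse x \<in> ?K"
    using J_closed(1) by (intro KI[of _ 0 1]) auto
  ultimately show "inverse x \<in> J" by simp
qed

end

lemma exists_valuation_ring:
  assumes "proper_rng R J0"
  obtains V J where "valuation_ring V J" "R \<subseteq> V" "J0 \<subseteq> J"
proof -
  obtain J where J: "proper_rng R J" "J0 \<subseteq> J" "\<And>K. proper_rng R K \<Longrightarrow> J \<subseteq> K \<Longrightarrow> K = J"
    using exists_maximal_proper_rng[OF assms] by blast
  show thesis
  proof (rule that)
    show "valuation_ring {x. \<forall>j\<in>J. x * j \<in> J} J"
      using J(1,3) by (rule multiplier_valuation_ring)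
    show "R \<subseteq> {x. \<forall>j\<in>J. x * j \<in> J}"
      using J(1) by (auto simp: proper_rng_def)
  qed (rule J(2))
qed

text \<open>For transcendental \<open>t\<close>, the rational polynomials in
  \<open>inverse t\<close> without constant term do not produce 1. They extend to the maximal ideal
  of a valuation ring, which then contains \<open>inverse t\<close> and cannot have \<open>t\<close>
  in its ring.\<close>

lemma algebraic_if_in_valuation_rings:
  fixes t :: "'a::field_char_0"
  assumes "\<And>V I. valuation_ring V I \<Longrightarrow> \<rat> \<subseteq> V \<Longrightarrow> t \<in> V"
  shows "algebraic t"
proof (rule ccontr)
  assume t: "\<not> algebraic t"
  then have "t \<noteq> 0"
    by auto
  have inv: "\<not> algebraic (inverse t)"
    using t algebraic_inverse[of "inverse t"] by auto
  let ?J = "{poly P (inverse t) |P. (\<forall>i. coeff P i \<in> \<rat>) \<and> coeff P 0 = 0}"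
  have JI: "u \<in> ?J" if "u = poly P (inverse t)" "\<And>i. coeff P i \<in> \<rat>" "coeff P 0 = 0" for u P
    using that by blast
  have "proper_rng \<rat> ?J"
    unfolding proper_rng_def
  proof (intro conjI ballI)
    show "0 \<in> ?J"
      by (rule JI[of _ 0]) auto
    show "1 \<notin> ?J"
    proof
      assume "1 \<in> ?J"
      then obtain P where P: "poly P (inverse t) = 1" "\<And>i. coeff P i \<in> \<rat>" "coeff P 0 = 0"
        by auto
      \<comment> \<open>The constant coefficient of \<open>P - 1\<close> is -1, so the algebraic
        relation for \<open>inverse t\<close> is not trivial.\<close>
      have "coeff (P - 1) 0 \<noteq> 0"
        using P(3) by simp
      then have "P - 1 \<noteq> 0"
        by force
      moreover have "coeff (P - 1) i \<in> \<rat>" for i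
        using P(2) by (auto simp: coeff_1)
      ultimately have "algebraic (inverse t)"
        using P(1) by (intro algebraicI'[of "P - 1"]) auto
      with inv show False by contradiction
    qed
  next
    fix u v assume "u \<in> ?J" "v \<in> ?J"
    then obtain P Q where *: "u = poly P (inverse t)" "v = poly Q (inverse t)"
      "\<And>i. coeff P i \<in> \<rat>" "\<And>i. coeff Q i \<in> \<rat>" "coeff P 0 = 0" "coeff Q 0 = 0" by blast
    show "u - v \<in> ?J"
      by (rule JI[of _ "P - Q"]) (use * in auto)
    show "u * v \<in> ?J"
      by (rule JI[of _ "P * Q"]) (use * in \<open>auto simp: coeff_mult intro!: Rats_sum\<close>)
  next
    fix r u :: 'a assume "r \<in> \<rat>" "u \<in> ?J"
    then obtain P where "u = poly P (inverse t)" "\<And>i. coeff P i \<in> \<rat>" "coeff P 0 = 0" by blast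
    with \<open>r \<in> \<rat>\<close> show "r * u \<in> ?J"
      by (intro JI[of _ "smult r P"]) auto
  qed
  then obtain V I where VI: "valuation_ring V I" "\<rat> \<subseteq> V" "?J \<subseteq> I"
    by (rule exists_valuation_ring)
  interpret valuation_ring V I by fact
  have "inverse t \<in> I"
    using VI(3) JI[of "inverse t" "[:0, 1:]"] by (auto simp: coeff_pCons split: nat.splits)
  then have "t * inverse t \<in> I"
    using assms[OF VI(1,2)] ideal_mult by blast
  with \<open>t \<noteq> 0\<close> one_notin_ideal show False by simp
qed

section \<open>Chebotarev's theorem modulo a valuation\<close>

text \<open>Such functions are the polynomial functions of degree less than \<open>n\<close>. The
  formulation by differences matches the effect of dividing by \<open>X - 1\<close> on a weighted
  coefficient sum.\<close>

fun nth_difference_zero :: "nat \<Rightarrow> (nat \<Rightarrow> int) \<Rightarrow> bool" where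
  "nth_difference_zero 0 Q \<longleftrightarrow> (\<forall>a. Q a = 0)"
| "nth_difference_zero (Suc n) Q \<longleftrightarrow> nth_difference_zero n (\<lambda>a. Q (Suc a) - Q a)"

lemma nth_difference_zero_add:
  "nth_difference_zero n Q \<Longrightarrow> nth_difference_zero n Q' \<Longrightarrow> nth_difference_zero n (\<lambda>a. Q a + Q' a)"
proof (induction n arbitrary: Q Q')
  case (Suc n)
  then have "nth_difference_zero n (\<lambda>a. (Q (Suc a) - Q a) + (Q' (Suc a) - Q' a))"
    by simp
  then show ?case
    by (simp add: algebra_simps)
qed simp

lemma nth_difference_zero_shift:
  "nth_difference_zero n Q \<Longrightarrow> nth_difference_zero n (\<lambda>a. Q (Suc a))"
proof (induction n arbitrary: Q)
  case (Suc n)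
  then show ?case
    using Suc.IH[of "\<lambda>a. Q (Suc a) - Q a"] by simp
qed simp

lemma nth_difference_zero_Suc: "nth_difference_zero n Q \<Longrightarrow> nth_difference_zero (Suc n) Q"
proof (induction n arbitrary: Q)
  case (Suc n)
  then have "nth_difference_zero (Suc n) (\<lambda>a. Q (Suc a) - Q a)"
    by (simp del: nth_difference_zero.simps(2) add: nth_difference_zero.simps(2)[of n Q])
  then show ?case
    by simp
qed simp

lemma nth_difference_zero_mono:
  "m \<le> n \<Longrightarrow> nth_difference_zero m Q \<Longrightarrow> nth_difference_zero n Q"
  by (induction rule: dec_induct) (blast intro: nth_difference_zero_Suc)+

text \<open>Discrete Leibniz rule: the difference of \<open>(a - b) Q(a)\<close> is
  \<open>(a - b)\<close> times the difference of \<open>Q\<close>, plus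
  \<open>Q(a + 1)\<close>.\<close>

lemma nth_difference_zero_mult:
  "nth_difference_zero n Q \<Longrightarrow> nth_difference_zero (Suc n) (\<lambda>a. (int a - b) * Q a)"
proof (induction n arbitrary: Q)
  case (Suc n)
  have "nth_difference_zero (Suc n) (\<lambda>a. (int a - b) * (Q (Suc a) - Q a) + Q (Suc a))"
    using Suc by (intro nth_difference_zero_add nth_difference_zero_shift) auto
  moreover have "(\<lambda>a. (int a - b) * (Q (Suc a) - Q a) + Q (Suc a)) =
      (\<lambda>a. (int (Suc a) - b) * Q (Suc a) - (int a - b) * Q a)"
    by (auto simp: algebra_simps)
  ultimately show ?case
    by simp
qed simp

lemma nth_difference_zero_prod:
  "finite A \<Longrightarrow> nth_difference_zero (Suc (card A)) (\<lambda>a. \<Prod>b\<in>A. int a - b)"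
  by (induction A rule: finite_induct) (auto simp del: nth_difference_zero.simps(2) dest: nth_difference_zero_mult simp: nth_difference_zero.simps(2)[of 0])

section \<open>Integers and roots of unity modulo the maximal ideal\<close>

context valuation_ring
begin

lemma coeff_synthetic_div_closed:
  "(\<And>i. coeff P i \<in> V) \<Longrightarrow> z \<in> V \<Longrightarrow> coeff (synthetic_div P z) i \<in> V"
proof (induction P arbitrary: i)
  case (pCons a P)
  have P: "coeff P i \<in> V" for i
    using pCons.prems(1)[of "Suc i"] by simp
  then have "poly P z \<in> V"
    using pCons.prems(2) by (auto simp: poly_altdef intro: sum_closed mult_closed power_closed)
  with P pCons show ?case
    by (auto simp: coeff_pCons split: nat.splits)
qed (simp add: zero_closed)

lemma of_int_notin_ideal:
  assumes "prime p" "of_nat p \<in> I" "\<not> int p dvd k"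
  shows "of_int k \<notin> I"
proof
  assume k: "of_int k \<in> I"
  have "coprime k (int p)"
    using assms(1,3) prime_imp_coprime[of "int p" k] by (simp add: coprime_commute)
  then obtain u v where "u * k + v * int p = 1"
    by (metis bezout_int coprime_imp_gcd_eq_1)
  then have "of_int u * of_int k + of_int v * of_nat p = (1::'a)"
    by (metis of_int_1 of_int_add of_int_mult of_int_of_nat_eq)
  moreover have "of_int u * of_int k + of_int v * of_nat p \<in> I"
    using assms(2) k by (intro ideal_add ideal_mult of_int_closed)
  ultimately show False
    using one_notin_ideal by metis
qed

lemma root_of_unity_closed: "z ^ n = 1 \<Longrightarrow> 0 < n \<Longrightarrow> z \<in> V"
  using power_closed_iff[of n z] one_closed by simp

text \<open>In residue characteristic \<open>p\<close> the Frobenius map is additive: expanding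
  \<open>(u + 1) ^ p\<close> with \<open>u = z - 1\<close>, all middle terms lie in
  \<open>I\<close>, hence so does \<open>u ^ p\<close>.\<close>

lemma pth_root_of_unity_cong_1:
  assumes p: "prime p" "of_nat p \<in> I" and z: "z ^ p = 1"
  shows "z - 1 \<in> I"
proof -
  have p0: "0 < p"
    using p(1) prime_gt_0_nat by blast
  define u where "u = z - 1"
  have u: "u \<in> V"
    unfolding u_def using root_of_unity_closed[OF z p0] one_closed by (rule diff_closed)
  have "1 = (u + 1) ^ p"
    by (simp add: u_def z)
  also have "\<dots> = (\<Sum>k\<le>p. of_nat (p choose k) * u ^ k)"
    by (simp add: binomial_ring)
  also have "{..p} = insert 0 (insert p {0<..<p})"
    using p0 by auto
  also have "(\<Sum>k\<in>insert 0 (insert p {0<..<p}). of_nat (p choose k) * u ^ k) =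
      1 + (u ^ p + (\<Sum>k\<in>{0<..<p}. of_nat (p choose k) * u ^ k))"
    using p0 by simp
  finally have "u ^ p = - (\<Sum>k\<in>{0<..<p}. of_nat (p choose k) * u ^ k)"
    by (simp add: eq_neg_iff_add_eq_0)
  also have "\<dots> \<in> I"
  proof (intro ideal_uminus ideal_sum)
    fix k assume "k \<in> {0<..<p}"
    then have "p dvd p choose k"
      using p(1) by (intro dvd_choose_prime) auto
    then obtain m where "p choose k = m * p"
      by (metis dvd_def mult.commute)
    then show "of_nat (p choose k) * u ^ k \<in> I"
      using ideal_mult_right[OF ideal_mult[OF of_nat_closed p(2)] power_closed[OF u]] by simp
  qed
  finally show ?thesis
    unfolding u_def by (rule ideal_prime_power)
qed

text \<open>If \<open>z\<close> were congruent to 1, the vanishing sum of its first \<open>p\<close>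
  powers would be congruent to \<open>p\<close>.\<close>

lemma root_of_unity_ne_1_mod:
  assumes "0 < p" "of_nat p \<notin> I" and z: "z ^ p = 1" "z \<noteq> 1"
  shows "z - 1 \<notin> I"
proof
  assume u: "z - 1 \<in> I"
  have z_V: "z \<in> V"
    using root_of_unity_closed assms(1,3) by blast
  have "z ^ k - 1 \<in> I" for k
  proof (induction k)
    case (Suc k)
    have "z ^ Suc k - 1 = z * (z ^ k - 1) + (z - 1)"
      by (simp add: algebra_simps)
    also have "\<dots> \<in> I"
      using Suc u z_V by (intro ideal_add ideal_mult)
    finally show ?case .
  qed (simp add: ideal_zero)
  then have "(\<Sum>k<p. z ^ k - 1) \<in> I"
    by (intro ideal_sum)
  moreover have "(\<Sum>k<p. z ^ k) = 0"
    using z by (simp add: sum_gp_strict)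
  ultimately have "- (of_nat p) \<in> I"
    by (simp add: sum_subtractf)
  with assms(2) ideal_uminus show False by fastforce
qed

text \<open>
  Reduced modulo \<open>I\<close>, the hypothesis says that \<open>P\<close> is divisible by \<open>(X - 1) ^ card Z\<close>, and dividing
  by one factor \<open>X - 1\<close> turns \<open>Q\<close> into its difference. The ideal \<open>I'\<close> is that of a coarser valuation.
\<close>

lemma sum_difference_coeff_in_ideal:
  assumes V': "valuation_ring V' I'" "I' \<subseteq> I" "V \<subseteq> V'"
  shows "finite Z \<Longrightarrow> (\<And>z. z \<in> Z \<Longrightarrow> z \<in> V \<and> z - 1 \<in> I \<and> poly P z \<in> I') \<Longrightarrow>
     (\<And>z w. z \<in> Z \<Longrightarrow> w \<in> Z \<Longrightarrow> z \<noteq> w \<Longrightarrow> z - w \<notin> I') \<Longrightarrow>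
     (\<And>i. coeff P i \<in> V) \<Longrightarrow> degree P \<le> n \<Longrightarrow> nth_difference_zero (card Z) Q \<Longrightarrow>
     (\<Sum>a\<le>n. of_int (Q a) * coeff P a) \<in> I"
proof (induction Z arbitrary: P Q rule: finite_induct)
  case empty
  then show ?case
    by (simp add: ideal_zero)
next
  case (insert z Z)
  interpret V': valuation_ring V' I' by (rule V'(1))
  define R where "R = synthetic_div P z"
  have z: "z \<in> V" "z - 1 \<in> I" "poly P z \<in> I'"
    using insert.prems(1) by auto
  have P: "P = [:- z, 1:] * R + [:poly P z:]"
    unfolding R_def by (rule synthetic_div_correct'[symmetric])
  have R: "coeff R i \<in> V" for i
    unfolding R_def by (intro coeff_synthetic_div_closed insert.prems(3) z)
  have deg: "degree R \<le> n"
    using insert.prems(4) by (simp add: R_def degree_synthetic_div)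
  have coeff_P: "coeff P a = (case a of 0 \<Rightarrow> poly P z | Suc b \<Rightarrow> coeff R b) - z * coeff R a" for a
    by (subst P) (simp add: coeff_pCons split: nat.splits)
  \<comment> \<open>The quotient has no coefficient at \<open>n\<close>, so the sum shifted by one
    index may again run up to \<open>n\<close>.\<close>
  have "coeff P (Suc n) = 0" "coeff R (Suc n) = 0"
    using insert.prems(4) deg by (auto intro: coeff_eq_0)
  then have Rn: "coeff R n = 0"
    using coeff_P[of "Suc n"] by simp
  have "(\<Sum>a\<le>n. of_int (Q a) * coeff P a) =
      (\<Sum>a\<le>n. of_int (Q a) * (case a of 0 \<Rightarrow> poly P z | Suc b \<Rightarrow> coeff R b)) -
      (\<Sum>a\<le>n. of_int (Q a) * (z * coeff R a))"
    by (simp add: coeff_P right_diff_distrib sum_subtractf)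
  also have "(\<Sum>a\<le>n. of_int (Q a) * (case a of 0 \<Rightarrow> poly P z | Suc b \<Rightarrow> coeff R b)) =
      of_int (Q 0) * poly P z + (\<Sum>a<n. of_int (Q (Suc a)) * coeff R a)"
    by (simp add: sum.atMost_shift)
  also have "(\<Sum>a<n. of_int (Q (Suc a)) * coeff R a) = (\<Sum>a\<le>n. of_int (Q (Suc a)) * coeff R a)"
    using Rn by (simp add: lessThan_Suc_atMost[symmetric])
  \<comment> \<open>The weight \<open>Q(a + 1) - z Q(a)\<close> is the difference of
    \<open>Q\<close> minus \<open>(z - 1) Q(a)\<close>, and \<open>z - 1\<close> lies in
    \<open>I\<close>.\<close>
  also have "of_int (Q 0) * poly P z + \<dots> - (\<Sum>a\<le>n. of_int (Q a) * (z * coeff R a)) =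
      of_int (Q 0) * poly P z + (\<Sum>a\<le>n. of_int (Q (Suc a) - Q a) * coeff R a)
        - (z - 1) * (\<Sum>a\<le>n. of_int (Q a) * coeff R a)"
    by (simp add: algebra_simps sum_subtractf sum_distrib_left)
  also have "\<dots> \<in> I"
  proof (intro ideal_diff ideal_add)
    show "of_int (Q 0) * poly P z \<in> I"
      using z(3) V'(2) by (intro ideal_mult of_int_closed) auto
    show "(z - 1) * (\<Sum>a\<le>n. of_int (Q a) * coeff R a) \<in> I"
      using z(2) R by (intro ideal_mult_right sum_closed mult_closed of_int_closed)
    show "(\<Sum>a\<le>n. of_int (Q (Suc a) - Q a) * coeff R a) \<in> I"
    proof (rule insert.IH)
      show "w \<in> V \<and> w - 1 \<in> I \<and> poly R w \<in> I'" if w: "w \<in> Z" for w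
      proof (intro conjI)
        have ne: "w - z \<notin> I'"
          using insert.hyps(2) insert.prems(2)[of w z] w by auto
        have "poly P w = (w - z) * poly R w + poly P z"
          by (subst P) (simp add: algebra_simps)
        then have "(w - z) * poly R w = poly P w - poly P z"
          by simp
        also have "\<dots> \<in> I'"
          using insert.prems(1)[of w] w z by (intro V'.ideal_diff) auto
        finally show "poly R w \<in> I'"
          using ne V'.ideal_prime by blast
      qed (use insert.prems(1) w in auto)
      show "nth_difference_zero (card Z) (\<lambda>a. Q (Suc a) - Q a)"
        using insert.prems(5) insert.hyps by simp
    qed (use insert.prems R deg in auto)
  qed
  finally show ?case .
qed

text \<open>
  Chebotarev's theorem on the minors of the Fourier matrix of prime order, over the residue field
  of a valuation ring of residue characteristic zero. Following Frenkel, the coefficients are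
  reduced modulo a prime above \<open>p\<close>, where all \<open>p\<close>-th roots of unity collapse to \<open>1\<close>.
\<close>

theorem sparse_poly_coeffs_in_ideal:
  fixes f :: "nat \<Rightarrow> 'a"
  assumes p: "prime p" and unit: "\<And>k::int. k \<noteq> 0 \<Longrightarrow> of_int k \<notin> I"
    and A: "A \<subseteq> {..<p}" and Z: "finite Z" "\<And>z. z \<in> Z \<Longrightarrow> z ^ p = 1" and card: "card A \<le> card Z"
    and f: "\<And>a. a \<in> A \<Longrightarrow> f a \<in> V"
    and vanish: "\<And>z. z \<in> Z \<Longrightarrow> (\<Sum>a\<in>A. f a * z ^ a) \<in> I"
    and "a \<in> A"
  shows "f a \<in> I"
proof (rule ccontr)
  assume "f a \<notin> I"
  have fin: "finite A"
    using A finite_subset by blast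
  have p0: "0 < p"
    using p prime_gt_0_nat by blast
  \<comment> \<open>To refine the valuation to one of residue characteristic \<open>p\<close>, its
    ideal has to contain both \<open>I\<close> and \<open>p\<close>. The set generated misses 1,
    since every \<open>1 - p k\<close> is a nonzero integer and so lies outside
    \<open>I\<close>.\<close>
  let ?J0 = "{of_nat p * of_int k + x |k x. x \<in> I}"
  have J0I: "u \<in> ?J0" if "u = of_nat p * of_int k + x" "x \<in> I" for u k x
    using that by blast
  have "proper_rng {} ?J0"
    unfolding proper_rng_def
  proof (intro conjI ballI)
    show "0 \<in> ?J0"
      by (rule J0I[of _ 0 0]) (auto intro: ideal_zero)
    show "1 \<notin> ?J0"
    proof
      assume "1 \<in> ?J0"
      then obtain k x where kx: "1 = of_nat p * of_int k + x" "x \<in> I"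
        by blast
      then have "of_int (1 - int p * k) = x"
        by (simp add: diff_eq_eq add.commute)
      moreover have "1 - int p * k \<noteq> 0"
        using p by (metis dvd_triv_left eq_iff_diff_eq_0 int_dvd_int_iff not_prime_unit of_nat_1)
      ultimately show False
        using unit kx(2) by metis
    qed
  next
    fix u v assume "u \<in> ?J0" "v \<in> ?J0"
    then obtain k x l y where *: "u = of_nat p * of_int k + x" "v = of_nat p * of_int l + y"
      "x \<in> I" "y \<in> I" by blast
    show "u - v \<in> ?J0"
      by (rule J0I[of _ "k - l" "x - y"]) (use * in \<open>auto simp: algebra_simps intro: ideal_diff\<close>)
    have "of_nat p * of_int k \<in> V" "of_nat p * of_int l \<in> V"
      by (auto intro: mult_closed of_nat_closed of_int_closed)
    from ideal_mult[OF this(1) *(4)] ideal_mult[OF this(2) *(3)] ideal_mult[OF in_V[OF *(3)] *(4)]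
    have "of_nat p * of_int k * y + of_nat p * of_int l * x + x * y \<in> I"
      by (intro ideal_add)
    then show "u * v \<in> ?J0"
      by (rule J0I[of _ "int p * k * l", rotated]) (use * in \<open>simp add: algebra_simps\<close>)
  qed simp
  then obtain W J where W: "valuation_ring W J" "?J0 \<subseteq> J"
    by (rule exists_valuation_ring)
  interpret W: valuation_ring W J by (rule W(1))
  have IJ: "I \<subseteq> J"
    using W(2) J0I[of _ 0] by auto
  have pJ: "of_nat p \<in> J"
    using W(2) J0I[of "of_nat p" 1 0] ideal_zero by auto
  have WV: "W \<subseteq> V"
  proof
    fix w assume "w \<in> W"
    show "w \<in> V"
    proof (rule ccontr)
      assume "w \<notin> V"
      then have "w * inverse w \<in> J" "w \<noteq> 0"
        using \<open>w \<in> W\<close> IJ inverse_in_ideal W.ideal_mult zero_closed by auto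
      then show False
        using W.one_notin_ideal by simp
    qed
  qed
  \<comment> \<open>Dominance is now taken with respect to the finer ring \<open>W\<close>: after
    division by \<open>f m\<close> all coefficients lie in \<open>W\<close> and the one at
    \<open>m\<close> is 1.\<close>
  obtain m where m: "m \<in> A" "f m \<noteq> 0" "\<And>x. x \<in> A \<Longrightarrow> f x / f m \<in> W"
    using W.exists_dominant[OF fin \<open>a \<in> A\<close>, of f] \<open>f a \<notin> I\<close> ideal_zero by metis
  have "f m \<notin> I"
  proof
    assume "f m \<in> I"
    then have "f a / f m * f m \<in> I"
      using m(3) \<open>a \<in> A\<close> WV by (intro ideal_mult) auto
    with \<open>f a \<notin> I\<close> m(2) show False by simp
  qed
  then have inv: "inverse (f m) \<in> V"
    by (rule inverse_closed)
  define P where "P = (\<Sum>x\<in>A. monom (f x / f m) x)"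
  have coeff_P: "coeff P x = (if x \<in> A then f x / f m else 0)" for x
    using fin by (simp add: P_def coeff_sum coeff_monom)
  have P_W: "coeff P x \<in> W" for x
    using m(3) by (simp add: coeff_P W.zero_closed)
  have deg: "degree P \<le> p"
    using A by (intro degree_le) (auto simp: coeff_P)
  \<comment> \<open>This weight vanishes at every exponent of \<open>A\<close> except
    \<open>m\<close>, and its degree \<open>card A - 1\<close> is below
    \<open>card Z\<close>.\<close>
  define Q where "Q x = (\<Prod>b\<in>int ` (A - {m}). int x - b)" for x :: nat
  have "card (int ` (A - {m})) = card A - 1"
    using fin m(1) by (simp add: card_image)
  moreover have "card A > 0"
    using fin m(1) card_gt_0_iff by blast
  ultimately have "nth_difference_zero (card A) Q"
    unfolding Q_def using nth_difference_zero_prod[of "int ` (A - {m})"] fin by simp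
  then have Q: "nth_difference_zero (card Z) Q"
    using card nth_difference_zero_mono by blast
  have Z_unit: "z - w \<notin> I" if "z \<in> Z" "w \<in> Z" "z \<noteq> w" for z w
  proof
    assume "z - w \<in> I"
    have w0: "w \<noteq> 0"
      using Z(2)[OF that(2)] p0 by (auto simp: power_0_left)
    have "(z / w) ^ p = 1" "z / w \<noteq> 1"
      using Z(2) that w0 by (auto simp: power_divide)
    then have "z / w - 1 \<notin> I"
      using unit[of "int p"] p0 by (intro root_of_unity_ne_1_mod[OF p0]) auto
    moreover have "inverse w \<in> V"
      using root_of_unity_closed[of "inverse w" p] Z(2) that(2) p0 by (simp add: power_inverse)
    then have "inverse w * (z - w) \<in> I"
      using \<open>z - w \<in> I\<close> by (rule ideal_mult)
    ultimately show False
      using w0 by (simp add: field_simps)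
  qed
  have "(\<Sum>x\<le>p. of_int (Q x) * coeff P x) \<in> J"
  proof (rule W.sum_difference_coeff_in_ideal[OF valuation_ring_axioms IJ WV Z(1) _ Z_unit P_W deg Q])
    fix z assume z: "z \<in> Z"
    have "poly P z = inverse (f m) * (\<Sum>x\<in>A. f x * z ^ x)"
      by (simp add: P_def poly_sum poly_monom sum_distrib_left field_simps)
    also have "\<dots> \<in> I"
      using inv vanish[OF z] by (rule ideal_mult)
    finally show "z \<in> W \<and> z - 1 \<in> J \<and> poly P z \<in> I"
      using W.root_of_unity_closed W.pth_root_of_unity_cong_1 Z(2)[OF z] p p0 pJ by blast
  qed
  \<comment> \<open>Only the term at \<open>m\<close> survives, so the product of the differences
    \<open>m - b\<close> lies in \<open>J\<close>; but these are nonzero and smaller than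
    \<open>p\<close> in absolute value.\<close>
  also have "(\<Sum>x\<le>p. of_int (Q x) * coeff P x) = (\<Sum>x\<in>{m}. of_int (Q x) * coeff P x)"
    using A m(1) fin by (intro sum.mono_neutral_right) (auto simp: coeff_P Q_def)
  also have "\<dots> = (\<Prod>b\<in>A - {m}. of_int (int m - int b))"
    using m by (simp add: coeff_P Q_def prod.reindex)
  finally obtain b where b: "b \<in> A - {m}" "of_int (int m - int b) \<in> J"
    using W.ideal_prime_prod[of "A - {m}"] fin by blast
  have "\<not> int p dvd int m - int b"
  proof
    assume "int p dvd int m - int b"
    moreover have "m < p" "b < p" "m \<noteq> b"
      using A b(1) m(1) by auto
    then have "\<bar>int m - int b\<bar> < int p" "int m - int b \<noteq> 0"
      by linarith+
    ultimately show False
      by (metis dvd_imp_le_int abs_of_nat linorder_not_less)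
  qed
  with W.of_int_notin_ideal[OF p pJ] b(2) show False by blast
qed

end

section \<open>Consequences of the pentagon equation\<close>

context metric_group
begin

abbreviation b :: "'a \<Rightarrow> 'a \<Rightarrow> complex" where "b \<equiv> pairing G q"

lemma b_mult_left:
  "x \<in> carrier G \<Longrightarrow> x' \<in> carrier G \<Longrightarrow> y \<in> carrier G \<Longrightarrow> b (x \<otimes> x') y = b x y * b x' y"
  using bicharacter_pairing by (auto simp: bicharacter_def)

lemma b_nonzero: "x \<in> carrier G \<Longrightarrow> y \<in> carrier G \<Longrightarrow> b x y \<noteq> 0"
  using bicharacter_pairing by (auto simp: bicharacter_def)

lemma b_commute: "x \<in> carrier G \<Longrightarrow> y \<in> carrier G \<Longrightarrow> b x y = b y x"
  by (simp add: pairing_def m_comm mult.commute)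

lemma b_mult_right:
  "x \<in> carrier G \<Longrightarrow> y \<in> carrier G \<Longrightarrow> y' \<in> carrier G \<Longrightarrow> b x (y \<otimes> y') = b x y * b x y'"
  using bicharacter_pairing by (auto simp: bicharacter_def)

lemma q_mult: "x \<in> carrier G \<Longrightarrow> y \<in> carrier G \<Longrightarrow> q (x \<otimes> y) = q x * q y * b x y"
  by (simp add: pairing_def q_nonzero)

lemma b_one_left: "y \<in> carrier G \<Longrightarrow> b \<one> y = 1"
  using b_mult_left[of \<one> \<one> y] b_nonzero[of \<one> y] by simp

lemma b_one_right: "y \<in> carrier G \<Longrightarrow> b y \<one> = 1"
  using b_one_left[of y] b_commute[of y \<one>] by simp

lemma q_one: "q \<one> = 1"
  using b_one_left[of \<one>] q_nonzero[of \<one>] by (simp add: pairing_def)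

lemma b_inv_left: "x \<in> carrier G \<Longrightarrow> y \<in> carrier G \<Longrightarrow> b (inv x) y = inverse (b x y)"
  using b_mult_left[of x "inv x" y] b_nonzero[of x y] b_one_left[of y] by (simp add: field_simps)

lemma b_inv_right: "x \<in> carrier G \<Longrightarrow> y \<in> carrier G \<Longrightarrow> b x (inv y) = inverse (b x y)"
  using b_inv_left[of y x] b_commute[of x "inv y"] b_commute[of x y] by simp

text \<open>Evaluate \<open>q\<close> at \<open>x \<otimes> inv x\<close>: evenness turns
  \<open>q \<one> = 1\<close> into \<open>q x ^ 2 = b x x\<close>.\<close>

lemma b_self:
  assumes "x \<in> carrier G" shows "b x x = q x ^ 2"
proof -
  have "b x x * b x (inv x) = 1" "q x ^ 2 * b x (inv x) = 1"
    using b_inv_right[of x x] q_mult[of x "inv x"] q_even[of x] q_one b_nonzero[of x x] assms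
    by (simp_all add: power2_eq_square)
  then show ?thesis
    by Groebner_Basis.algebra
qed

lemma b_pow: "x \<in> carrier G \<Longrightarrow> y \<in> carrier G \<Longrightarrow> b (x [^] (n::nat)) y = b x y ^ n"
  by (induction n) (simp_all add: b_one_left b_mult_left)

text \<open>Translating by \<open>x\<close> permutes the group and multiplies the product of all
  \<open>b z y\<close> by a power of \<open>b x y\<close>.\<close>

lemma b_root_of_unity:
  assumes "x \<in> carrier G" "y \<in> carrier G"
  shows "b x y ^ Coset.order G = 1"
proof -
  have "(\<Prod>z\<in>carrier G. b z y) = (\<Prod>z\<in>carrier G. b (x \<otimes> z) y)"
    by (rule prod.reindex_bij_witness[of _ "\<lambda>z. x \<otimes> z" "\<lambda>z. inv x \<otimes> z"])
      (use assms in \<open>auto simp: m_assoc[symmetric]\<close>)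
  also have "\<dots> = b x y ^ Coset.order G * (\<Prod>z\<in>carrier G. b z y)"
    using assms by (simp add: b_mult_left prod.distrib Coset.order_def)
  finally show ?thesis
    using assms(2) b_nonzero finite_carrier by simp
qed

lemma q_root_of_unity: "x \<in> carrier G \<Longrightarrow> q x ^ (2 * Coset.order G) = 1"
  using b_root_of_unity[of x x] by (simp add: b_self power_mult)

lemma sum_mult_left:
  assumes "a \<in> carrier G"
  shows "(\<Sum>z\<in>carrier G. f (a \<otimes> z)) = (\<Sum>z\<in>carrier G. f z)"
  by (rule sum.reindex_bij_witness[of _ "\<lambda>z. inv a \<otimes> z" "\<lambda>z. a \<otimes> z"])
    (use assms in \<open>auto simp: m_assoc[symmetric]\<close>)

lemma sum_inv: "(\<Sum>z\<in>carrier G. f (inv z)) = (\<Sum>z\<in>carrier G. f z)"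
  by (rule sum.reindex_bij_witness[of _ "\<lambda>z. inv z" "\<lambda>z. inv z"]) auto

lemma sum_b:
  assumes w: "w \<in> carrier G"
  shows "(\<Sum>z\<in>carrier G. b z w) = (if w = \<one> then of_nat (Coset.order G) else 0)"
proof (cases "w = \<one>")
  case True
  then show ?thesis
    by (simp add: b_one_right Coset.order_def)
next
  case False
  then obtain x where x: "x \<in> carrier G" "b x w \<noteq> 1"
    using nondegenerate_pairing w unfolding nondegenerate_def by blast
  have "(\<Sum>z\<in>carrier G. b z w) = (\<Sum>z\<in>carrier G. b (x \<otimes> z) w)"
    by (rule sum_mult_left[OF x(1), symmetric])
  also have "\<dots> = b x w * (\<Sum>z\<in>carrier G. b z w)"
    using x w by (simp add: b_mult_left sum_distrib_left)
  finally show ?thesis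
    using x(2) False by simp
qed

text \<open>Unnormalised, with kernel \<open>b\<close> itself: applied twice it gives the reflected
  function times the group order.\<close>

definition fourier :: "('a \<Rightarrow> complex) \<Rightarrow> 'a \<Rightarrow> complex" where
  "fourier f w = (\<Sum>z\<in>carrier G. b z w * f z)"

lemma fourier_inversion:
  assumes x: "x \<in> carrier G"
  shows "(\<Sum>w\<in>carrier G. b x w * fourier f w) = of_nat (Coset.order G) * f (inv x)"
proof -
  have "(\<Sum>w\<in>carrier G. b x w * fourier f w) =
      (\<Sum>w\<in>carrier G. \<Sum>z\<in>carrier G. f z * b w (x \<otimes> z))"
    unfolding fourier_def sum_distrib_left using x
    by (intro sum.cong) (auto simp: b_mult_right b_commute)
  also have "\<dots> = (\<Sum>z\<in>carrier G. f z * (\<Sum>w\<in>carrier G. b w (x \<otimes> z)))"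
    by (subst sum.swap) (simp add: sum_distrib_left)
  also have "\<dots> = (\<Sum>z\<in>carrier G. if z = inv x then f z * of_nat (Coset.order G) else 0)"
  proof (intro sum.cong refl)
    fix z assume z: "z \<in> carrier G"
    have "x \<otimes> z = \<one> \<longleftrightarrow> z = inv x"
      using x z by (metis inv_equality m_comm r_inv)
    then show "f z * (\<Sum>w\<in>carrier G. b w (x \<otimes> z)) = (if z = inv x then f z * of_nat (Coset.order G) else 0)"
      using x z by (simp add: sum_b)
  qed
  also have "\<dots> = of_nat (Coset.order G) * f (inv x)"
    using x finite_carrier by simp
  finally show ?thesis .
qed

lemma fourier_convolution:
  assumes w: "w \<in> carrier G"
  shows "(\<Sum>x\<in>carrier G. b x w * (\<Sum>z\<in>carrier G. k z * f (x \<otimes> inv z))) = fourier k w * fourier f w"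
proof -
  have "(\<Sum>x\<in>carrier G. b x w * (\<Sum>z\<in>carrier G. k z * f (x \<otimes> inv z))) =
      (\<Sum>z\<in>carrier G. \<Sum>x\<in>carrier G. b x w * (k z * f (x \<otimes> inv z)))"
    unfolding sum_distrib_left by (rule sum.swap)
  also have "\<dots> = (\<Sum>z\<in>carrier G. b z w * k z * fourier f w)"
  proof (intro sum.cong refl)
    fix z assume z: "z \<in> carrier G"
    have "(\<Sum>x\<in>carrier G. b x w * (k z * f (x \<otimes> inv z))) =
        (\<Sum>x\<in>carrier G. b (z \<otimes> x) w * (k z * f (z \<otimes> x \<otimes> inv z)))"
      by (rule sum_mult_left[OF z, symmetric])
    also have "\<dots> = (\<Sum>x\<in>carrier G. b z w * k z * (b x w * f x))"
    proof (intro sum.cong refl)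
      fix x assume x: "x \<in> carrier G"
      have "z \<otimes> x \<otimes> inv z = x"
        using x z by (metis inv_solve_right m_closed m_comm)
      then show "b (z \<otimes> x) w * (k z * f (z \<otimes> x \<otimes> inv z)) = b z w * k z * (b x w * f x)"
        using x z w by (simp add: b_mult_left)
    qed
    finally show "(\<Sum>x\<in>carrier G. b x w * (k z * f (x \<otimes> inv z))) = b z w * k z * fourier f w"
      by (simp add: fourier_def sum_distrib_left)
  qed
  finally show ?thesis
    by (simp add: fourier_def sum_distrib_right)
qed

end

section \<open>The pentagon equation after Fourier transform\<close>

locale pentagon = metric_group G q for G (structure) and q +
  fixes E :: "'a \<Rightarrow> complex" and C s :: complex
  assumes C_nonzero: "C \<noteq> 0"
    and s_square: "s ^ 2 = of_nat (Coset.order G)"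
    and pentagon: "x \<in> carrier G \<Longrightarrow> y \<in> carrier G \<Longrightarrow> b x y * E x * E y =
      C + 1 / s * (\<Sum>z\<in>carrier G. E (y \<otimes> inv z) * E z * q z * E (x \<otimes> inv z))"
    and nontrivial: "carrier G \<noteq> {\<one>}"
begin

lemma order_nonzero: "(of_nat (Coset.order G) :: complex) \<noteq> 0"
  using finite_carrier by (auto simp: Coset.order_def)

lemma s_nonzero: "s \<noteq> 0"
  using s_square order_nonzero by auto

text \<open>The part of the pentagon sum independent of \<open>x\<close>, so that the sum is the
  convolution of \<open>K y\<close> with \<open>E\<close>.\<close>

definition K :: "'a \<Rightarrow> 'a \<Rightarrow> complex" where
  "K y z = E (y \<otimes> inv z) * E z * q z"

abbreviation \<phi> :: "'a \<Rightarrow> complex" where "\<phi> \<equiv> fourier E"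

text \<open>Transform the pentagon equation in \<open>x\<close>: the factor \<open>b x y\<close>
  shifts the frequency by \<open>y\<close>, the convolution becomes a product, and the constant
  \<open>C\<close> is concentrated at frequency \<open>\<one>\<close>.\<close>

lemma fourier_K:
  assumes w: "w \<in> carrier G" and y: "y \<in> carrier G"
  shows "fourier (K y) w * \<phi> w =
    s * (E y * \<phi> (w \<otimes> y)) - (if w = \<one> then s * C * of_nat (Coset.order G) else 0)"
proof -
  have "E y * \<phi> (w \<otimes> y) = (\<Sum>x\<in>carrier G. b x w * (b x y * E x * E y))"
    unfolding fourier_def sum_distrib_left using w y
    by (intro sum.cong) (auto simp: b_mult_right)
  also have "\<dots> = (\<Sum>x\<in>carrier G. b x w * (C + 1 / s * (\<Sum>z\<in>carrier G. K y z * E (x \<otimes> inv z))))"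
    using y by (intro sum.cong) (auto simp: pentagon K_def)
  also have "\<dots> = C * (\<Sum>x\<in>carrier G. b x w) +
      1 / s * (\<Sum>x\<in>carrier G. b x w * (\<Sum>z\<in>carrier G. K y z * E (x \<otimes> inv z)))"
    by (simp add: distrib_left sum.distrib sum_distrib_left mult_ac)
  finally have "E y * \<phi> (w \<otimes> y) = C * (if w = \<one> then of_nat (Coset.order G) else 0)
      + 1 / s * (fourier (K y) w * \<phi> w)"
    unfolding fourier_convolution[OF w] sum_b[OF w] .
  then show ?thesis
    using s_nonzero by (auto simp: field_simps)
qed

text \<open>The substitution of \<open>y \<otimes> inv z\<close> for \<open>z\<close> exchanges the
  two values of \<open>E\<close> in \<open>K y z\<close>, while the change in \<open>q\<close>
  alters the character.\<close>

lemma fourier_K_reflect: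
  assumes w: "w \<in> carrier G" and y: "y \<in> carrier G"
  shows "q w * fourier (K y) w = q (y \<otimes> w) * fourier (K y) (inv (y \<otimes> w))"
proof -
  have "fourier (K y) w = (\<Sum>z\<in>carrier G. b (y \<otimes> inv z) w * K y (y \<otimes> inv z))"
    unfolding fourier_def
    by (subst sum_mult_left[OF y, symmetric], subst sum_inv[symmetric]) (rule refl)
  also have "\<dots> = (\<Sum>z\<in>carrier G. q y * b y w * (b z (inv (y \<otimes> w)) * K y z))"
  proof (intro sum.cong refl)
    fix z assume z: "z \<in> carrier G"
    have "y \<otimes> inv (y \<otimes> inv z) = z"
      using y z by (simp add: inv_mult m_assoc[symmetric])
    moreover have "q (y \<otimes> inv z) = q y * q z * inverse (b y z)"
      using y z q_even[of z] by (simp add: q_mult b_inv_right)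
    moreover have "b z (inv (y \<otimes> w)) = inverse (b y z) * inverse (b z w)"
      using y z w b_commute[of y z] by (simp add: b_inv_right b_mult_right)
    moreover have "b (y \<otimes> inv z) w = b y w * inverse (b z w)"
      using y z w by (simp add: b_mult_left b_inv_left)
    ultimately show "b (y \<otimes> inv z) w * K y (y \<otimes> inv z) = q y * b y w * (b z (inv (y \<otimes> w)) * K y z)"
      by (simp add: K_def)
  qed
  also have "\<dots> = q y * b y w * fourier (K y) (inv (y \<otimes> w))"
    by (simp add: fourier_def sum_distrib_left)
  finally show ?thesis
    using y w by (simp add: q_mult)
qed

lemma phi_one_nonzero: "\<phi> \<one> \<noteq> 0"
  using fourier_K[of \<one> \<one>] C_nonzero s_nonzero order_nonzero by auto

text \<open>The frequencies \<open>\<one>\<close> and \<open>inv y\<close> are exchanged by the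
  reflection; eliminating the transform of \<open>K y\<close> from \<open>fourier_K\<close> at both
  gives the relation.\<close>

lemma phi_inv_relation:
  assumes y: "y \<in> carrier G" "y \<noteq> \<one>"
  shows "\<phi> (inv y) * (E y * \<phi> y - C * of_nat (Coset.order G)) = q y * \<phi> \<one> ^ 2 * E y"
proof -
  have "fourier (K y) \<one> * \<phi> \<one> = s * (E y * \<phi> y) - s * C * of_nat (Coset.order G)"
    using fourier_K[of \<one> y] y by simp
  moreover have "fourier (K y) (inv y) * \<phi> (inv y) = s * (E y * \<phi> \<one>)"
    using fourier_K[of "inv y" y] y by simp
  moreover have "fourier (K y) \<one> = q y * fourier (K y) (inv y)"
    using fourier_K_reflect[of \<one> y] y by (simp add: q_one)
  ultimately have "s * (\<phi> (inv y) * (E y * \<phi> y - C * of_nat (Coset.order G))) =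
      s * (q y * \<phi> \<one> ^ 2 * E y)"
    by Groebner_Basis.algebra
  then show ?thesis
    using s_nonzero by simp
qed

text \<open>A zero at \<open>v\<close> makes \<open>\<phi>\<close> vanish at \<open>inv v\<close>.
  At that frequency \<open>fourier_K\<close> shows that, for each \<open>z\<close>,
  \<open>E z\<close> or \<open>\<phi> (inv v \<otimes> z)\<close> is zero, and the latter forces
  \<open>E (v \<otimes> inv z) = 0\<close>. So \<open>K v\<close> vanishes identically, against the
  nonzero constant at frequency \<open>\<one>\<close>.\<close>

lemma E_nonzero:
  assumes v: "v \<in> carrier G" "v \<noteq> \<one>"
  shows "E v \<noteq> 0"
proof
  assume Ev: "E v = 0"
  then have phi_v: "\<phi> (inv v) = 0"
    using phi_inv_relation[OF v] C_nonzero order_nonzero by auto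
  have "E (v \<otimes> inv z) * E z = 0" if z: "z \<in> carrier G" for z
  proof (cases "z = v")
    case False
    have "E z * \<phi> (inv v \<otimes> z) = 0"
      using fourier_K[of "inv v" z] z v phi_v s_nonzero by simp
    moreover have "E (v \<otimes> inv z) = 0" if "\<phi> (inv v \<otimes> z) = 0"
    proof -
      have ne: "v \<otimes> inv z \<noteq> \<one>"
        using False v z by (metis inv_equality inv_inv inv_closed)
      have "\<phi> (inv (v \<otimes> inv z)) = 0"
        using that v z by (simp add: inv_mult)
      then show ?thesis
        using phi_inv_relation[OF _ ne] v z phi_one_nonzero q_nonzero by simp
    qed
    ultimately show ?thesis by auto
  qed (use Ev in simp)
  then have "fourier (K v) \<one> = 0"
    unfolding fourier_def K_def by (intro sum.neutral) auto
  then show False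
    using fourier_K[of \<one> v] v Ev s_nonzero C_nonzero order_nonzero by simp
qed

lemma phi_nonzero: "w \<in> carrier G \<Longrightarrow> \<phi> w \<noteq> 0"
  using phi_one_nonzero phi_inv_relation[of "inv w"] E_nonzero[of "inv w"] q_nonzero[of "inv w"]
  by (cases "w = \<one>") (auto dest!: inv_equality[rotated])

text \<open>With \<open>d = y \<otimes> inv x\<close>, the reflection for \<open>K d\<close>
  exchanges the frequencies \<open>x\<close> and \<open>inv y\<close>, and the common factor
  \<open>E d\<close> is nonzero.\<close>

lemma phi_product_relation:
  assumes "x \<in> carrier G" "x \<noteq> \<one>" "y \<in> carrier G" "y \<noteq> \<one>"
  shows "\<phi> y * \<phi> (inv y) * q x = \<phi> x * \<phi> (inv x) * q y"
proof (cases "x = y")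
  case False
  define d where "d = y \<otimes> inv x"
  have d: "d \<in> carrier G" "d \<otimes> x = y" "x \<otimes> d = y"
    using assms by (simp_all add: d_def m_assoc m_lcomm[of x y])
  have "d \<noteq> \<one>"
    using d(2) assms False by auto
  then have Ed: "E d \<noteq> 0"
    using E_nonzero d by blast
  have "inv y \<noteq> \<one>"
    using assms by (metis inv_inv inv_one)
  moreover have "inv y \<otimes> d = inv x"
    using assms by (simp add: d_def m_assoc[symmetric])
  ultimately have "fourier (K d) x * \<phi> x = s * (E d * \<phi> y)"
    "fourier (K d) (inv y) * \<phi> (inv y) = s * (E d * \<phi> (inv x))"
    using fourier_K[of x d] fourier_K[of "inv y" d] assms d by simp_all
  moreover have "q x * fourier (K d) x = q y * fourier (K d) (inv y)"
    using fourier_K_reflect[of x d] assms d by simp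
  ultimately have "s * E d * (\<phi> y * \<phi> (inv y) * q x) = s * E d * (\<phi> x * \<phi> (inv x) * q y)"
    by Groebner_Basis.algebra
  then show ?thesis
    using s_nonzero Ed by simp
qed simp

lemma phi_eq:
  obtains g h where "g \<noteq> 0" "h \<noteq> 0"
    "\<And>y. y \<in> carrier G \<Longrightarrow> y \<noteq> \<one> \<Longrightarrow> \<phi> (inv y) = g * q y * E y"
    "\<And>y. y \<in> carrier G \<Longrightarrow> y \<noteq> \<one> \<Longrightarrow> q y * E y * E (inv y) = h"
    "g * C * of_nat (Coset.order G) = g ^ 2 * h - \<phi> \<one> ^ 2"
proof -
  obtain a where a: "a \<in> carrier G" "a \<noteq> \<one>"
    using nontrivial one_closed by blast
  define \<eta> where "\<eta> = \<phi> a * \<phi> (inv a) / q a"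
  have \<eta>: "\<phi> y * \<phi> (inv y) = \<eta> * q y" if "y \<in> carrier G" "y \<noteq> \<one>" for y
    using phi_product_relation[OF a that] q_nonzero a by (simp add: \<eta>_def field_simps)
  \<comment> \<open>Once \<open>\<phi> y * \<phi> (inv y)\<close> is replaced by
    \<open>\<eta> * q y\<close>, \<open>phi_inv_relation\<close> becomes linear in
    \<open>\<phi> (inv y)\<close>, with this factor of proportionality.\<close>
  define g where "g = (\<eta> - \<phi> \<one> ^ 2) / (C * of_nat (Coset.order G))"
  have CN: "C * of_nat (Coset.order G) \<noteq> 0"
    using C_nonzero order_nonzero by simp
  have g: "\<phi> (inv y) = g * q y * E y" if y: "y \<in> carrier G" "y \<noteq> \<one>" for y
  proof -
    have "\<phi> (inv y) * (C * of_nat (Coset.order G)) = (\<eta> - \<phi> \<one> ^ 2) * q y * E y"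
      using phi_inv_relation[OF y] \<eta>[OF y] by Groebner_Basis.algebra
    then show ?thesis
      using CN by (simp add: g_def field_simps)
  qed
  have "g \<noteq> 0"
    using g[OF a] phi_nonzero[of "inv a"] a by auto
  define h where "h = \<eta> / g ^ 2"
  have h: "q y * E y * E (inv y) = h" if y: "y \<in> carrier G" "y \<noteq> \<one>" for y
  proof -
    have "inv y \<noteq> \<one>"
      using y by (metis inv_inv inv_one)
    then have "\<phi> y = g * q y * E (inv y)"
      using g[of "inv y"] y q_even[of y] by simp
    then have "q y * (g ^ 2 * (q y * E y * E (inv y))) = q y * \<eta>"
      using g[OF y] \<eta>[OF y] by (simp add: power2_eq_square mult_ac)
    then show ?thesis
      using q_nonzero[of y] y \<open>g \<noteq> 0\<close> by (simp add: h_def field_simps)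
  qed
  show thesis
  proof (rule that[of g h])
    show "h \<noteq> 0"
      using h[OF a] E_nonzero[of a] E_nonzero[of "inv a"] q_nonzero[of a] a
      by (metis inv_closed inv_inv inv_one mult_eq_0_iff)
    show "g * C * of_nat (Coset.order G) = g ^ 2 * h - \<phi> \<one> ^ 2"
      using CN \<open>g \<noteq> 0\<close> by (simp add: h_def g_def)
  qed (use \<open>g \<noteq> 0\<close> g h in auto)
qed

text \<open>
  In the second case \<open>q\<close> is the constant \<open>c\<^sup>2 / h\<close> off \<open>\<one>\<close>, which only happens for very small groups.
\<close>

lemma dilogarithm_cases:
  obtains (generic) g where
    "E \<one> ^ 2 = s * E \<one> + 1"
    "\<And>y. y \<in> carrier G \<Longrightarrow> y \<noteq> \<one> \<Longrightarrow> q y * E y * E (inv y) = 1"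
    "\<And>y. y \<in> carrier G \<Longrightarrow> \<phi> (inv y) = g * q y * E y"
  | (degenerate) c h where
    "h \<noteq> 0" "E \<one> ^ 2 = s * E \<one> + h"
    "\<And>y. y \<in> carrier G \<Longrightarrow> y \<noteq> \<one> \<Longrightarrow> q y * E y * E (inv y) = h"
    "\<And>y. y \<in> carrier G \<Longrightarrow> y \<noteq> \<one> \<Longrightarrow> q y * E y = c"
proof -
  obtain g h where g0: "g \<noteq> 0" and h0: "h \<noteq> 0"
    and g: "\<And>y. y \<in> carrier G \<Longrightarrow> y \<noteq> \<one> \<Longrightarrow> \<phi> (inv y) = g * q y * E y"
    and h: "\<And>y. y \<in> carrier G \<Longrightarrow> y \<noteq> \<one> \<Longrightarrow> q y * E y * E (inv y) = h"
    and gC: "g * C * of_nat (Coset.order G) = g ^ 2 * h - \<phi> \<one> ^ 2"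
    by (rule phi_eq) blast
  let ?N = "of_nat (Coset.order G) :: complex"
  let ?e = "E \<one>"
  have N: "?N = s * s"
    using s_square by (simp add: power2_eq_square)
  have inv_ne: "inv y \<noteq> \<one>" if "y \<in> carrier G" "y \<noteq> \<one>" for y
    using that by (metis inv_inv inv_one)
  \<comment> \<open>A function constant off \<open>\<one>\<close> transforms into a multiple of the
    delta function plus a constant.\<close>
  have sum_delta: "(\<Sum>z\<in>carrier G. b z w * f z) = c * (if w = \<one> then ?N else 0) + (f \<one> - c)"
    if "w \<in> carrier G" and "\<And>z. z \<in> carrier G \<Longrightarrow> z \<noteq> \<one> \<Longrightarrow> f z = c"
    for w c and f :: "'a \<Rightarrow> complex"
  proof -
    note w = that(1) and f = that(2)
    have "(\<Sum>z\<in>carrier G. b z w * f z) = (\<Sum>z\<in>carrier G. c * b z w + (if z = \<one> then f z - c else 0))"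
      using f b_one_left w by (intro sum.cong) auto
    also have "\<dots> = c * (if w = \<one> then ?N else 0) + (f \<one> - c)"
      using finite_carrier by (simp add: sum.distrib sum_b[OF w] flip: sum_distrib_left)
    finally show ?thesis .
  qed
  have K_one: "fourier (K \<one>) w = h * (if w = \<one> then ?N else 0) + (?e ^ 2 - h)" if "w \<in> carrier G" for w
    using sum_delta[OF that, of "K \<one>" h] h
    by (simp add: fourier_def K_def q_one power2_eq_square mult_ac)
  obtain a where a: "a \<in> carrier G" "a \<noteq> \<one>"
    using nontrivial one_closed by blast
  \<comment> \<open>Take \<open>y = \<one>\<close> in \<open>fourier_K\<close> at a frequency other
    than \<open>\<one>\<close> and cancel the nonzero \<open>\<phi> a\<close>. Frequency
    \<open>\<one>\<close> gives \<open>h_phi\<close> below.\<close>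
  have e: "?e ^ 2 = s * ?e + h"
  proof -
    have "(?e ^ 2 - h) * \<phi> a = s * ?e * \<phi> a"
      using fourier_K[of a \<one>] a K_one[of a] by simp
    then have "?e ^ 2 - h = s * ?e"
      using phi_nonzero[OF a(1)] by simp
    then show ?thesis
      by (simp add: diff_eq_eq)
  qed
  have h_phi: "h * \<phi> \<one> = - s * C"
  proof -
    have "(h * ?N + (?e ^ 2 - h)) * \<phi> \<one> = s * ?e * \<phi> \<one> - s * C * ?N"
      using fourier_K[of \<one> \<one>] K_one[of \<one>] by simp
    then have "?N * (h * \<phi> \<one>) = ?N * (- s * C)"
      using e by Groebner_Basis.algebra
    then show ?thesis
      using order_nonzero mult_left_cancel[of ?N] by blast
  qed
  have phi_one_sq: "\<phi> \<one> ^ 2 = g ^ 2 * h + g * s * (h * \<phi> \<one>)"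
    using gC by (simp add: h_phi N algebra_simps)
  \<comment> \<open>The value at frequency \<open>\<one>\<close> is the same for all
    \<open>y \<noteq> \<one>\<close>, so as a function of \<open>y\<close> it can be transformed by
    \<open>sum_delta\<close>.\<close>
  have K_sum: "g * fourier (K y) \<one> = s * \<phi> \<one>" if y: "y \<in> carrier G" "y \<noteq> \<one>" for y
  proof -
    have "\<phi> y = g * q y * E (inv y)"
      using g[of "inv y"] inv_ne y q_even[of y] by simp
    then have "fourier (K y) \<one> * \<phi> \<one> = s * g * (q y * E y * E (inv y)) - s * C * (s * s)"
      using fourier_K[of \<one> y] y by (simp add: N)
    also have "\<dots> = s * g * h + s * s * (h * \<phi> \<one>)"
      using h[OF y] h_phi by simp
    finally have "\<phi> \<one> * (g * fourier (K y) \<one>) = s * (g ^ 2 * h + g * s * (h * \<phi> \<one>))"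
      by (simp add: algebra_simps power2_eq_square)
    also have "\<dots> = \<phi> \<one> * (s * \<phi> \<one>)"
      unfolding phi_one_sq[symmetric] by (simp add: power2_eq_square)
    finally show ?thesis
      using phi_one_nonzero by simp
  qed
  \<comment> \<open>Off \<open>\<one>\<close>, \<open>g * q y * E y\<close> is
    \<open>\<phi> (inv y)\<close>, so inversion applies; the mismatch at \<open>\<one>\<close>
    contributes the constant.\<close>
  have fourier_qE: "g * fourier (\<lambda>z. q z * E z) w = ?N * E w + (g * ?e - \<phi> \<one>)"
    if w: "w \<in> carrier G" for w
  proof -
    have "g * fourier (\<lambda>z. q z * E z) w =
        (\<Sum>y\<in>carrier G. b y w * \<phi> (inv y) + (if y = \<one> then g * ?e - \<phi> \<one> else 0))"
      unfolding fourier_def[of "\<lambda>z. q z * E z"] sum_distrib_left using w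
      by (intro sum.cong) (auto simp: g q_one b_one_left)
    also have "\<dots> = (\<Sum>y\<in>carrier G. b y w * \<phi> (inv y)) + (g * ?e - \<phi> \<one>)"
      using finite_carrier by (simp add: sum.distrib)
    also have "(\<Sum>y\<in>carrier G. b y w * \<phi> (inv y)) = (\<Sum>y\<in>carrier G. b (inv w) y * \<phi> y)"
      using w by (subst sum_inv[symmetric], intro sum.cong) (auto simp: b_inv_left b_commute[of w])
    also have "\<dots> = ?N * E w"
      using w by (simp add: fourier_inversion)
    finally show ?thesis .
  qed
  \<comment> \<open>The sum over \<open>z\<close> of \<open>K y z\<close> is, in \<open>y\<close>,
    the convolution of \<open>q\<close> times \<open>E\<close> with \<open>E\<close>. Its transform,
    computed as a product and from \<open>K_sum\<close>, gives a factored identity whose two factors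
    are the two cases.\<close>
  have key: "(g * ?e - \<phi> \<one>) * (g * (q w * E (inv w)) - s) = 0"
    if w: "w \<in> carrier G" "w \<noteq> \<one>" for w
  proof -
    have phi_w: "\<phi> w = g * q w * E (inv w)"
      using g[of "inv w"] inv_ne w q_even[of w] by simp
    have K1: "fourier (K \<one>) \<one> = h * ?N + s * ?e"
      using K_one[of \<one>] e by simp
    have "(\<Sum>y\<in>carrier G. b y w * (g * fourier (K y) \<one>)) = g * fourier (K \<one>) \<one> - s * \<phi> \<one>"
      using sum_delta[OF w(1), of "\<lambda>y. g * fourier (K y) \<one>"] K_sum w(2) by simp
    moreover have "(\<Sum>y\<in>carrier G. b y w * (g * fourier (K y) \<one>)) =
        g * (\<Sum>y\<in>carrier G. b y w * (\<Sum>z\<in>carrier G. (q z * E z) * E (y \<otimes> inv z)))"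
      unfolding sum_distrib_left fourier_def
      by (intro sum.cong) (auto simp: b_one_right K_def)
    ultimately have "g * fourier (\<lambda>z. q z * E z) w * \<phi> w = g * (h * ?N + s * ?e) - s * \<phi> \<one>"
      unfolding fourier_convolution[OF w(1), of "\<lambda>z. q z * E z" E] K1 by (simp only: mult.assoc)
    then have "(?N * E w + (g * ?e - \<phi> \<one>)) * (g * q w * E (inv w)) = g * (h * ?N + s * ?e) - s * \<phi> \<one>"
      unfolding fourier_qE[OF w(1)] phi_w .
    then have "?N * g * (q w * E w * E (inv w)) + (g * ?e - \<phi> \<one>) * (g * (q w * E (inv w))) =
        ?N * g * h + s * (g * ?e - \<phi> \<one>)"
      by (simp add: algebra_simps)
    then show ?thesis
      unfolding h[OF w] by (simp add: algebra_simps)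
  qed
  show thesis
  \<comment> \<open>Equality extends the proportionality to \<open>\<one>\<close>, and comparing
    \<open>phi_one_sq\<close> with \<open>e\<close> then yields \<open>h = 1\<close>. Otherwise the
    second factor in \<open>key\<close> vanishes.\<close>
  proof (cases "\<phi> \<one> = g * ?e")
    case True
    have "g ^ 2 * ?e ^ 2 = g ^ 2 * (h + s * h * ?e)"
      using phi_one_sq unfolding True by (simp add: algebra_simps power2_eq_square)
    with e g0 have "s * ?e * (h - 1) = 0"
      by (simp add: algebra_simps)
    moreover have "?e \<noteq> 0"
      using e h0 by auto
    ultimately have "h = 1"
      using s_nonzero by simp
    show thesis
    proof (rule generic)
      show "\<phi> (inv y) = g * q y * E y" if "y \<in> carrier G" for y
        using g[OF that] True by (cases "y = \<one>") (auto simp: q_one)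
    qed (use e h \<open>h = 1\<close> in auto)
  next
    case False
    show thesis
    proof (rule degenerate)
      show "q y * E y = s / g" if y: "y \<in> carrier G" "y \<noteq> \<one>" for y
      proof -
        have "g * (q y * E y) = s"
          using key[of "inv y"] inv_ne[OF y] y False q_even[of y] by simp
        then show ?thesis
          using g0 by (simp add: field_simps)
      qed
    qed (use e h h0 in auto)
  qed
qed

end

section \<open>Algebraicity over cyclic groups of prime order\<close>

lemma (in pentagon) generic_in_valuation_ring:
  fixes V I :: "complex set"
  assumes VI: "valuation_ring V I" "\<rat> \<subseteq> V"
    and p: "prime p" and order: "Coset.order G = p"
    and \<gamma>: "\<gamma> \<in> carrier G" "bij_betw (\<lambda>n::nat. \<gamma> [^] n) {..<p} (carrier G)"
    and E_one: "E \<one> ^ 2 = s * E \<one> + 1"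
    and E_inv: "\<And>y. y \<in> carrier G \<Longrightarrow> y \<noteq> \<one> \<Longrightarrow> q y * E y * E (inv y) = 1"
    and \<phi>: "\<And>y. y \<in> carrier G \<Longrightarrow> \<phi> (inv y) = g * q y * E y"
    and u: "u \<in> carrier G"
  shows "E u \<in> V"
proof (rule ccontr)
  assume Eu: "E u \<notin> V"
  interpret V: valuation_ring V I by (rule VI(1))
  have p0: "0 < p"
    using p prime_gt_0_nat by blast
  have unit: "of_int k \<notin> I" if "k \<noteq> 0" for k
  proof
    assume "of_int k \<in> I"
    moreover have "inverse (of_int k) \<in> V"
      using VI(2) by auto
    ultimately have "inverse (of_int k) * of_int k \<in> I"
      by (intro V.ideal_mult)
    with that V.one_notin_ideal show False by simp
  qed
  have q_V: "q x \<in> V" "inverse (q x) \<in> V" if "x \<in> carrier G" for x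
    using q_root_of_unity[OF that] p0 order
    by (auto intro!: V.root_of_unity_closed[of _ "2 * p"] simp: power_inverse)
  have b_V: "b x y \<in> V" if "x \<in> carrier G" "y \<in> carrier G" for x y
    using b_root_of_unity[OF that] p0 order by (auto intro!: V.root_of_unity_closed[of _ p])
  have "s \<in> V"
    by (rule V.power_closed_iff[of 2]) (simp_all add: s_square V.of_nat_closed)
  have E_one_V: "E \<one> \<in> V"
    using \<open>s \<in> V\<close> E_one by (rule V.quadratic_root_closed)
  obtain m where m: "m \<in> carrier G" "E m \<noteq> 0" "\<And>x. x \<in> carrier G \<Longrightarrow> E x / E m \<in> V"
    using V.exists_dominant[OF finite_carrier u, of E] Eu V.zero_closed by metis
  define f where "f x = E x / E m" for x
  have f_V: "f x \<in> V" if "x \<in> carrier G" for x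
    using m(3)[OF that] by (simp add: f_def)
  have "E m \<notin> V"
  proof
    assume "E m \<in> V"
    then have "f u * E m \<in> V"
      using f_V[OF u] by (intro V.mult_closed)
    with Eu m(2) show False by (simp add: f_def)
  qed
  then have Em: "inverse (E m) \<in> I"
    by (rule V.inverse_in_ideal)
  have f_one: "f \<one> \<in> I"
    using V.ideal_mult[OF E_one_V Em] by (simp add: f_def field_simps)
  \<comment> \<open>The product of the two values is a unit times
    \<open>inverse (E m) ^ 2\<close>.\<close>
  have f_inv: "f x \<in> I \<or> f (inv x) \<in> I" if x: "x \<in> carrier G" for x
  proof (cases "x = \<one>")
    case False
    have "f x * f (inv x) = inverse (q x) * inverse (E m) ^ 2"
      using E_inv[OF x False] q_nonzero[OF x] m(2) by (simp add: f_def field_simps power2_eq_square)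
    also have "\<dots> \<in> I"
      using q_V(2)[OF x] Em by (intro V.ideal_mult V.ideal_power) auto
    finally show ?thesis
      by (rule V.ideal_prime)
  qed (use f_one in simp)
  have fourier_f: "(\<Sum>x\<in>carrier G. b x (inv y) * f x) = g * q y * f y" if "y \<in> carrier G" for y
    using arg_cong[OF \<phi>[OF that], of "\<lambda>t. t / E m"]
    by (simp add: fourier_def f_def sum_divide_distrib)
  \<comment> \<open>At \<open>m\<close> the normalised value is 1, so the transform there is
    \<open>g * q m\<close> itself.\<close>
  have "g * q m \<in> V"
  proof -
    have "g * q m = (\<Sum>x\<in>carrier G. b x (inv m) * f x)"
      using fourier_f[OF m(1)] m(2) by (simp add: f_def[of m])
    also have "\<dots> \<in> V"
      using m(1) f_V b_V by (intro V.sum_closed V.mult_closed) auto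
    finally show ?thesis .
  qed
  then have "inverse (q m) * (g * q m) \<in> V"
    using q_V(2)[OF m(1)] by (rule V.mult_closed[rotated])
  also have "inverse (q m) * (g * q m) = g"
    using q_nonzero[OF m(1)] by simp
  finally have g: "g \<in> V" .
  \<comment> \<open>\<open>A\<close> is the support of \<open>f\<close> modulo \<open>I\<close>. At
    \<open>inv y\<close> with \<open>y \<in> B\<close> the transform lies in \<open>I\<close>, and
    inversion maps \<open>A\<close> into \<open>B\<close>, so there are at least as many such zeros
    as terms.\<close>
  define A where "A = {x \<in> carrier G. f x \<notin> I}"
  define B where "B = carrier G - A - {\<one>}"
  \<comment> \<open>Exponents of the generator turn \<open>f\<close> on \<open>A\<close> into a
    sparse polynomial, evaluated at the \<open>p\<close>-th roots of unity in
    \<open>Z\<close>.\<close>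
  define A' where "A' = {n \<in> {..<p}. \<gamma> [^] n \<in> A}"
  define Z where "Z = (\<lambda>y. b \<gamma> (inv y)) ` B"
  have A: "A \<subseteq> carrier G" "finite A" and B: "B \<subseteq> carrier G" "finite B"
    using finite_carrier by (auto simp: A_def B_def)
  have A'_A: "bij_betw (\<lambda>n. \<gamma> [^] n) A' A"
    unfolding bij_betw_def
  proof
    show "inj_on (\<lambda>n. \<gamma> [^] n) A'"
      using bij_betw_imp_inj_on[OF \<gamma>(2)] by (rule inj_on_subset) (auto simp: A'_def)
    show "(\<lambda>n. \<gamma> [^] n) ` A' = A"
    proof (intro equalityI subsetI)
      fix x assume "x \<in> A"
      then have "x \<in> (\<lambda>n. \<gamma> [^] n) ` {..<p}"
        using bij_betw_imp_surj_on[OF \<gamma>(2)] A(1) by auto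
      with \<open>x \<in> A\<close> show "x \<in> (\<lambda>n. \<gamma> [^] n) ` A'"
        by (auto simp: A'_def)
    qed (auto simp: A'_def)
  qed
  have "inj_on (\<lambda>y. b \<gamma> (inv y)) B"
  proof (rule inj_onI)
    fix y y' assume y: "y \<in> B" "y' \<in> B" "b \<gamma> (inv y) = b \<gamma> (inv y')"
    have "b x (inv y \<otimes> y') = 1" if "x \<in> carrier G" for x
    proof -
      have "x \<in> (\<lambda>n::nat. \<gamma> [^] n) ` {..<p}"
        using bij_betw_imp_surj_on[OF \<gamma>(2)] that by simp
      then obtain n where "x = \<gamma> [^] (n::nat)" ..
      then have "b x (inv y) = b x (inv y')"
        using y \<gamma>(1) B(1) by (simp add: b_pow subset_iff)
      then show ?thesis
        using y that B(1) b_nonzero by (simp add: b_mult_right b_inv_right subset_iff)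
    qed
    then have "inv y \<otimes> y' = \<one>"
      using nondegenerate_pairing y B(1) unfolding nondegenerate_def by blast
    then have "inv y' = inv y"
      using y B(1) by (intro inv_equality) auto
    then show "y = y'"
      using y B(1) by (metis inv_inv subsetD)
  qed
  then have card_Z: "card Z = card B"
    unfolding Z_def by (rule card_image)
  have "inv x \<in> B" if "x \<in> A" for x
  proof -
    have x: "x \<in> carrier G" "f x \<notin> I"
      using that by (auto simp: A_def)
    then have "f (inv x) \<in> I" "x \<noteq> \<one>"
      using f_inv[of x] f_one by auto
    moreover from this x have "inv x \<noteq> \<one>"
      by (metis inv_inv inv_one)
    ultimately show ?thesis
      using x by (simp add: A_def B_def)
  qed
  then have "(\<lambda>x. inv x) ` A \<subseteq> B"
    by blast
  moreover have "inj_on (\<lambda>x. inv x) A"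
    using A(1) by (intro inj_onI) (metis inv_inv subsetD)
  ultimately have "card A \<le> card B"
    using B(2) card_inj_on_le by blast
  then have card: "card A' \<le> card Z"
    using bij_betw_same_card[OF A'_A] card_Z by simp
  have "m \<in> A"
    using m(1,2) V.one_notin_ideal by (simp add: A_def f_def)
  then have "m \<in> (\<lambda>n. \<gamma> [^] n) ` A'"
    using bij_betw_imp_surj_on[OF A'_A] by simp
  then obtain n where n: "n \<in> A'" "\<gamma> [^] n = m"
    by auto
  have "f (\<gamma> [^] n) \<in> I"
  proof (rule V.sparse_poly_coeffs_in_ideal[OF p unit _ _ _ card])
    show "A' \<subseteq> {..<p}" "finite Z" "n \<in> A'"
      using B(2) n by (auto simp: A'_def Z_def)
    show "z ^ p = 1" if "z \<in> Z" for z
      using that b_root_of_unity[OF \<gamma>(1)] B(1) order by (auto simp: Z_def)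
    show "f (\<gamma> [^] k) \<in> V" for k :: nat
      using f_V \<gamma>(1) by simp
    fix z assume "z \<in> Z"
    then obtain y where y: "y \<in> B" "z = b \<gamma> (inv y)"
      by (auto simp: Z_def)
    then have yG: "y \<in> carrier G"
      using B(1) by blast
    have "(\<Sum>k\<in>A'. f (\<gamma> [^] k) * z ^ k) = (\<Sum>k\<in>A'. b (\<gamma> [^] k) (inv y) * f (\<gamma> [^] k))"
      using \<gamma>(1) yG y(2) by (simp add: b_pow mult.commute)
    also have "\<dots> = (\<Sum>x\<in>A. b x (inv y) * f x)"
      by (rule sum.reindex_bij_betw[OF A'_A])
    \<comment> \<open>Restricting the transform to \<open>A\<close> drops only terms in
      \<open>I\<close>.\<close>
    also have "\<dots> = g * q y * f y - (\<Sum>x\<in>carrier G - A. b x (inv y) * f x)"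
      using sum.subset_diff[OF A(1) finite_carrier, of "\<lambda>x. b x (inv y) * f x"] fourier_f[OF yG] by simp
    also have "\<dots> \<in> I"
    proof (intro V.ideal_diff V.ideal_sum V.ideal_mult V.mult_closed)
      show "f y \<in> I" "g \<in> V" "q y \<in> V"
        using y yG g q_V by (auto simp: B_def A_def)
      fix x assume "x \<in> carrier G - A"
      then show "b x (inv y) \<in> V" "f x \<in> I"
        using b_V yG by (auto simp: A_def)
    qed
    finally show "(\<Sum>k\<in>A'. f (\<gamma> [^] k) * z ^ k) \<in> I" .
  qed auto
  with n m(2) V.one_notin_ideal show False
    by (simp add: f_def)
qed

text \<open>As the first three powers of \<open>\<gamma>\<close> are not \<open>\<one>\<close>, both
  \<open>b \<gamma> \<gamma>\<close> and \<open>b \<gamma> (\<gamma> \<otimes> \<gamma>)\<close>,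
  its square, equal \<open>d / (d * d)\<close>.\<close>

lemma (in metric_group) pairing_self_eq_1_if_q_constant:
  assumes \<gamma>: "\<gamma> \<in> carrier G" "\<gamma> [^] (2::nat) \<noteq> \<one>" "\<gamma> [^] (3::nat) \<noteq> \<one>"
    and q: "\<And>y. y \<in> carrier G \<Longrightarrow> y \<noteq> \<one> \<Longrightarrow> q y = d"
  shows "b \<gamma> \<gamma> = 1"
proof -
  have "\<gamma> \<noteq> \<one>"
    using \<gamma>(2) by (auto simp: nat_pow_one)
  have sq: "\<gamma> \<otimes> \<gamma> = \<gamma> [^] (2::nat)" "\<gamma> \<otimes> \<gamma> [^] (2::nat) = \<gamma> [^] (3::nat)"
    using \<gamma>(1) by (simp_all add: numeral_eq_Suc m_assoc)
  have "b \<gamma> \<gamma> = d / (d * d)" "b \<gamma> (\<gamma> \<otimes> \<gamma>) = d / (d * d)"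
    unfolding pairing_def sq using q \<gamma> \<open>\<gamma> \<noteq> \<one>\<close> by simp_all
  then have "b \<gamma> \<gamma> * b \<gamma> \<gamma> = b \<gamma> \<gamma>"
    using \<gamma>(1) by (simp add: b_mult_right)
  then show ?thesis
    using b_nonzero[of \<gamma> \<gamma>] \<gamma>(1) by simp
qed

theorem theorem9:
  fixes p :: nat and q E :: "int \<Rightarrow> complex"
  assumes "prime p"
    and "metric_group (integer_mod_group p) q"
    and "finite_quantum_dilogarithm (integer_mod_group p) q E"
  shows "\<forall>u\<in>carrier (integer_mod_group p). algebraic (E u)"
proof
  let ?G = "integer_mod_group p"
  fix u assume u: "u \<in> carrier ?G"
  interpret metric_group ?G q by (rule assms(2))
  have p1: "1 < p"
    using assms(1) prime_gt_1_nat by blast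
  have carrier: "carrier ?G = {0..<int p}"
    using p1 by (simp add: carrier_integer_mod_group)
  have order: "Coset.order ?G = p"
    by (simp add: Coset.order_def carrier)
  define s where "s = complex_of_real (sqrt (real (Coset.order ?G)))"
  obtain C where C: "C \<noteq> 0" "\<And>x y. x \<in> carrier ?G \<Longrightarrow> y \<in> carrier ?G \<Longrightarrow>
      pairing ?G q x y * E x * E y = C + 1 / s * (\<Sum>z\<in>carrier ?G.
        E (y \<otimes>\<^bsub>?G\<^esub> inv\<^bsub>?G\<^esub> z) * E z * q z * E (x \<otimes>\<^bsub>?G\<^esub> inv\<^bsub>?G\<^esub> z))"
    using assms(3) unfolding finite_quantum_dilogarithm_def s_def by blast
  have small: "E \<one>\<^bsub>?G\<^esub> ^ 2 = s * E \<one>\<^bsub>?G\<^esub> + 1" if "p \<le> 4"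
    using conjunct2[OF assms(3)[unfolded finite_quantum_dilogarithm_def]] that order
    by (simp add: s_def)
  interpret pentagon ?G q E C s
  proof
    show "s ^ 2 = of_nat (Coset.order ?G)"
      unfolding s_def by (simp flip: of_real_power)
    show "carrier ?G \<noteq> {\<one>\<^bsub>?G\<^esub>}"
      using p1 by (auto simp: carrier set_eq_iff intro!: exI[of _ 1])
  qed (use C in auto)
  have one: "1 \<in> carrier ?G"
    using p1 by (simp add: carrier)
  have pow: "1 [^]\<^bsub>?G\<^esub> n = int n" if "n < p" for n :: nat
    using that by simp
  have pow_nat: "1 [^]\<^bsub>?G\<^esub> (nat x) = x" if "x \<in> carrier ?G" for x
  proof -
    have "1 [^]\<^bsub>?G\<^esub> (nat x) = int (nat x)"
      using that by (intro pow) (auto simp: carrier)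
    also have "\<dots> = x"
      using that by (simp add: carrier)
    finally show ?thesis .
  qed
  show "algebraic (E u)"
  proof (rule dilogarithm_cases)
    fix g
    assume generic: "E \<one>\<^bsub>?G\<^esub> ^ 2 = s * E \<one>\<^bsub>?G\<^esub> + 1"
      "\<And>y. y \<in> carrier ?G \<Longrightarrow> y \<noteq> \<one>\<^bsub>?G\<^esub> \<Longrightarrow> q y * E y * E (inv\<^bsub>?G\<^esub> y) = 1"
      "\<And>y. y \<in> carrier ?G \<Longrightarrow> \<phi> (inv\<^bsub>?G\<^esub> y) = g * q y * E y"
    have "bij_betw (\<lambda>n::nat. 1 [^]\<^bsub>?G\<^esub> n) {..<p} (carrier ?G)"
    proof (rule bij_betw_byWitness[where f' = nat])
      show "\<forall>n\<in>{..<p}. nat (1 [^]\<^bsub>?G\<^esub> n) = n"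
        by simp
      show "\<forall>x\<in>carrier ?G. 1 [^]\<^bsub>?G\<^esub> (nat x) = x"
        using pow_nat by blast
    qed (auto simp: carrier)
    then show "algebraic (E u)"
      using generic_in_valuation_ring[OF _ _ assms(1) order one _ generic u]
      by (intro algebraic_if_in_valuation_rings) blast
  next
    fix c h
    assume h: "h \<noteq> 0" "E \<one>\<^bsub>?G\<^esub> ^ 2 = s * E \<one>\<^bsub>?G\<^esub> + h"
      and prod: "\<And>y. y \<in> carrier ?G \<Longrightarrow> y \<noteq> \<one>\<^bsub>?G\<^esub> \<Longrightarrow> q y * E y * E (inv\<^bsub>?G\<^esub> y) = h"
      and c: "\<And>y. y \<in> carrier ?G \<Longrightarrow> y \<noteq> \<one>\<^bsub>?G\<^esub> \<Longrightarrow> q y * E y = c"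
    have q: "q y * h = c ^ 2" if y: "y \<in> carrier ?G" "y \<noteq> \<one>\<^bsub>?G\<^esub>" for y
    proof -
      have "inv\<^bsub>?G\<^esub> y \<noteq> \<one>\<^bsub>?G\<^esub>"
        using y by (metis inv_inv inv_one)
      then have "q y * E (inv\<^bsub>?G\<^esub> y) = c"
        using c[of "inv\<^bsub>?G\<^esub> y"] y q_even[of y] inv_closed[of y] by metis
      then have "q y * (q y * E y * E (inv\<^bsub>?G\<^esub> y)) = c * c"
        using c[OF y] by (simp add: mult.left_commute)
      then show ?thesis
        unfolding prod[OF y] by (simp add: power2_eq_square)
    qed
    \<comment> \<open>For larger \<open>p\<close> the generator 1 would pair trivially with itself,
      hence with the whole group, against nondegeneracy.\<close>
    have "p \<le> 4"
    proof (rule ccontr)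
      assume "\<not> p \<le> 4"
      then have "b 1 1 = 1"
        using q h(1) one by (intro pairing_self_eq_1_if_q_constant[where d = "c ^ 2 / h"]) (auto simp: field_simps)
      moreover have "b x 1 = 1" if "x \<in> carrier ?G" for x
        using b_pow[OF one one, of "nat x"] unfolding pow_nat[OF that] \<open>b 1 1 = 1\<close> by simp
      ultimately have "1 = \<one>\<^bsub>?G\<^esub>"
        using nondegenerate_pairing one unfolding nondegenerate_def by blast
      then show False by simp
    qed
    \<comment> \<open>The extra condition for small groups enters here: compared with the equation
      containing \<open>h\<close>, it fixes \<open>h = 1\<close>.\<close>
    then have E1: "E \<one>\<^bsub>?G\<^esub> ^ 2 = s * E \<one>\<^bsub>?G\<^esub> + 1" and "h = 1"
      using small h(2) by auto
    show "algebraic (E u)"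
    proof (rule algebraic_if_in_valuation_rings)
      fix V I :: "complex set"
      assume "valuation_ring V I"
      then interpret V: valuation_ring V I .
      show "E u \<in> V"
      proof (cases "u = \<one>\<^bsub>?G\<^esub>")
        case True
        have "s \<in> V"
          by (rule V.power_closed_iff[of 2]) (simp_all add: s_square V.of_nat_closed del: power2_eq_iff)
        then show ?thesis
          unfolding True using E1 by (rule V.quadratic_root_closed)
      next
        case False
        \<comment> \<open>With \<open>h = 1\<close> and \<open>c = q u * E u\<close> this says
          \<open>q u * E u ^ 2 = 1\<close>; as \<open>q u\<close> is a root of unity, so is
          \<open>E u\<close>.\<close>
        have "q u * (q u * E u ^ 2) = q u * 1"
          using q[OF u False] unfolding c[OF u False, symmetric] \<open>h = 1\<close>
          by (simp add: power2_eq_square mult_ac)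
        then have "q u * E u ^ 2 = 1"
          using q_nonzero[OF u] mult_left_cancel[of "q u"] by blast
        then have "(q u * E u ^ 2) ^ (2 * p) = 1"
          by simp
        then have "E u ^ (2 * (2 * p)) = 1"
          using q_root_of_unity[OF u] by (simp add: power_mult_distrib order flip: power_mult)
        then show ?thesis
          using p1 by (intro V.root_of_unity_closed) auto
      qed
    qed
  qed
qed

end
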